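(* Let $a=(a_i)_{i\in\mathbb Z}$ be an arbitrary sequence of complex numbers and $\mu$ a Young diagram. Then $$s_{\mu;a}(x;y)=\sum_{\mathcal T}\prod_{i\ge1}f_{\mathcal T^{-1}(i);a}(x_i,y_i),$$ summed over all diagonal--strict tableaux $\mathcal T$ of shape $\mu$ (when $x_i=y_i=0$ for $i>n$, only tableaux with entries in $\{1,\dots,n\}$ contribute). Also, for every $n\ge1$, $$s_{\mu;a}(x_1,\dots,x_n;y_1,\dots,y_n)=\sum_T\ \prod_{\square\in\mu,\ T(\square)\in\{1,\dots,n\}}\big(x_{T(\square)}-a_{c(\square)}\big)\prod_{\square\in\mu,\ T(\square)\in\{1',\dots,n'\}}\big(y_{|T(\square)|}+a_{c(\square)}\big),$$ summed over all $\mathbb A$-tableaux $T$ of shape $\mu$ with entries in $\mathbb A_n=\{1'<1<\dots<n'<n\}$.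
   Context: The base field is $\mathbb C$. $\Lambda=\mathbb C[\mathbf p_1,\mathbf p_2,\dots]$ is the algebra of symmetric functions (polynomial ring in the power sums). Its elements $h_k$ are defined by $H(u)=1+\sum_{k\ge1}h_ku^{-k}=\exp\big(\sum_{k\ge1}\mathbf p_ku^{-k}/k\big)\in\Lambda[[u^{-1}]]$. For $f\in\Lambda$, $f(x;y)$ denotes the result of substituting $\mathbf p_k\mapsto\sum_ix_i^k+(-1)^{k-1}\sum_iy_i^k$, where $x=(x_1,x_2,\dots)$, $y=(y_1,y_2,\dots)$; $f(x_1,\dots,x_n;y_1,\dots,y_n)$ means all other variables are set to $0$. The elements $h_{k;a}\in\Lambda$ are defined by $1+\sum_{k\ge1}\frac{h_{k;a}}{(u-a_1)\cdots(u-a_k)}=H(u)$ in $\Lambda[[u^{-1}]]$, with $h_{0;a}=1$, $h_{k;a}=0$ for $k<0$. For $r\in\mathbb Z$, $(\tau^ra)_i=a_{i+r}$. The multiparameter Schur function is $s_{\mu;a}=\det[h_{\mu_i-i+j;\,\tau^{1-j}a}]$ (order any number $\ge\ell(\mu)$). Squares are written $(i,j)$ ($i$ row, $j$ column); the content of $\square=(i,j)$ is $c(\square)=j-i$. A diagonal--strict tableau of shape $\mu$ is a function $\mathcal T$ from the squares of $\mu$ to $\{1,2,\dots\}$ weakly increasing along rows (left to right) and down columns, and strictly increasing along the diagonals $j-i=\mathrm{const}$. Then each $\mathcal T^{-1}(i)$ is a skew diagram with no $2\times2$ block of squares. For a nonempty connected skew diagram $\nu$ with no $2\times2$ block of squares,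 $$f_{\nu;a}(u,v)=(u+v)\prod_{(i,j),(i,j+1)\in\nu}(u-a_{j-i+1})\prod_{(i,j),(i+1,j)\in\nu}(v+a_{j-i}),$$ the first product over pairs of horizontally adjacent squares of $\nu$, the second over pairs of vertically adjacent squares; for a general skew diagram with no $2\times2$ block of squares, $f_{\nu;a}$ is the product over its connected components (and $f_{\varnothing;a}=1$). An $\mathbb A$-tableau of shape $\mu$ is a map $T$ from the squares of $\mu$ to the ordered alphabet $\mathbb A=\{1'<1<2'<2<\dots\}$ such that the symbols weakly increase from left to right along each row and down each column, and for each $i$ there is at most one symbol $i'$ in each row and at most one symbol $i$ in each column. $|i'|=i$. *)

theory Defs
  imports
    Complex_Main
    "HOL-Library.Poly_Mapping"
    "HOL-Library.FuncSet"
    "HOL-Computational_Algebra.Formal_Power_Series"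
    "Jordan_Normal_Form.Determinant"
begin

section \<open>Formal power series in arbitrarily many variables\<close>

text \<open>
  The variables are the elements of \<^typ>\<open>'v\<close>, which may be infinite; a series is an arbitrary
  family of complex coefficients indexed by the monomials (finitely supported exponents).
\<close>

typedef 'v mps = "UNIV :: (('v \<Rightarrow>\<^sub>0 nat) \<Rightarrow> complex) set"
  morphisms mps_coeff Abs_mps ..

lemma mps_eqI: "(\<And>m. mps_coeff f m = mps_coeff g m) \<Longrightarrow> f = g"
  by (simp add: mps_coeff_inject[symmetric] fun_eq_iff)

lemma mps_coeff_Abs [simp]: "mps_coeff (Abs_mps f) = f"
  by (simp add: Abs_mps_inverse)

lemma finite_exponent_splits: "finite {(p, q). p + q = (m :: 'v \<Rightarrow>\<^sub>0 nat)}"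
proof -
  let ?P = "{p :: 'v \<Rightarrow>\<^sub>0 nat. \<forall>v. Poly_Mapping.lookup p v \<le> Poly_Mapping.lookup m v}"
  let ?B = "Max (insert 0 (Poly_Mapping.lookup m ` Poly_Mapping.keys m))"
  have "Poly_Mapping.lookup ` ?P \<subseteq> {f. \<forall>v. (v \<in> Poly_Mapping.keys m \<longrightarrow> f v \<in> {..?B}) \<and> (v \<notin> Poly_Mapping.keys m \<longrightarrow> f v = 0)}"
  proof (clarsimp, intro conjI impI)
    fix p :: "'v \<Rightarrow>\<^sub>0 nat" and v
    assume le: "\<forall>v. Poly_Mapping.lookup p v \<le> Poly_Mapping.lookup m v"
    { assume "v \<in> Poly_Mapping.keys m"
      then have "Poly_Mapping.lookup m v \<le> ?B" by (intro Max_ge) auto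
      with le[rule_format, of v] show "Poly_Mapping.lookup p v \<le> ?B" by (rule order_trans) }
    { assume "v \<notin> Poly_Mapping.keys m"
      then show "Poly_Mapping.lookup p v = 0" using le[rule_format, of v] by (simp add: in_keys_iff) }
  qed
  moreover have "finite {f. \<forall>v. (v \<in> Poly_Mapping.keys m \<longrightarrow> f v \<in> {..?B}) \<and> (v \<notin> Poly_Mapping.keys m \<longrightarrow> f v = (0::nat))}"
    by (rule finite_set_of_finite_funs) auto
  ultimately have "finite (Poly_Mapping.lookup ` ?P)" by (rule finite_subset)
  then have fin: "finite ?P"
    by (rule finite_imageD) (simp add: inj_on_def)
  have "{(p, q). p + q = m} \<subseteq> ?P \<times> ?P"
    by (auto simp: lookup_add)
  with fin show ?thesis by (meson finite_SigmaI finite_subset)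
qed

instantiation mps :: (type) comm_ring_1
begin

definition "0 = Abs_mps (\<lambda>_. 0)"
definition "1 = Abs_mps (\<lambda>m. if m = 0 then 1 else 0)"
definition "f + g = Abs_mps (\<lambda>m. mps_coeff f m + mps_coeff g m)"
definition "f - g = Abs_mps (\<lambda>m. mps_coeff f m - mps_coeff g m)"
definition "- f = Abs_mps (\<lambda>m. - mps_coeff f m)"
definition "f * g = Abs_mps (\<lambda>m. \<Sum>(p, q) \<in> {(p, q). p + q = m}. mps_coeff f p * mps_coeff g q)"

lemmas mps_ring_defs =
  zero_mps_def one_mps_def plus_mps_def minus_mps_def uminus_mps_def times_mps_def

instance
proof
  fix f g h :: "'a mps"
  show "f * g * h = f * (g * h)"
  proof (rule mps_eqI)
    fix m
    let ?F = "mps_coeff f" and ?G = "mps_coeff g" and ?H = "mps_coeff h"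
    let ?S = "\<lambda>m. {(p, q). p + q = (m :: 'a \<Rightarrow>\<^sub>0 nat)}"
    have "mps_coeff (f * g * h) m =
        (\<Sum>z\<in>?S m. \<Sum>w\<in>?S (fst z). ?F (fst w) * ?G (snd w) * ?H (snd z))"
      by (simp add: times_mps_def case_prod_unfold sum_distrib_right)
    also have "\<dots> = (\<Sum>(z, w)\<in>Sigma (?S m) (\<lambda>z. ?S (fst z)). ?F (fst w) * ?G (snd w) * ?H (snd z))"
      by (rule sum.Sigma) (auto simp only: finite_exponent_splits)
    also have "\<dots> = (\<Sum>(z, w)\<in>Sigma (?S m) (\<lambda>z. ?S (snd z)). ?F (fst z) * (?G (fst w) * ?H (snd w)))"
      by (rule sum.reindex_bij_witness[of _
            "\<lambda>((p, q), (r, s)). ((p + r, s), (p, r))"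
            "\<lambda>((p, q), (r, s)). ((r, s + q), (s, q))"])
         (auto simp: algebra_simps)
    also have "\<dots> = (\<Sum>z\<in>?S m. \<Sum>w\<in>?S (snd z). ?F (fst z) * (?G (fst w) * ?H (snd w)))"
      by (rule sum.Sigma[symmetric]) (auto simp only: finite_exponent_splits)
    also have "\<dots> = mps_coeff (f * (g * h)) m"
      by (simp add: times_mps_def case_prod_unfold sum_distrib_left)
    finally show "mps_coeff (f * g * h) m = mps_coeff (f * (g * h)) m" .
  qed
  show "f * g = g * f"
  proof (rule mps_eqI)
    fix m
    show "mps_coeff (f * g) m = mps_coeff (g * f) m"
      unfolding times_mps_def mps_coeff_Abs
      by (rule sum.reindex_bij_witness[of _ "\<lambda>(p, q). (q, p)" "\<lambda>(p, q). (q, p)"])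
         (auto simp: add.commute mult.commute)
  qed
  show "1 * f = f"
  proof (rule mps_eqI)
    fix m
    have "mps_coeff (1 * f) m =
        (\<Sum>z\<in>{(p, q). p + q = m}. if z = (0, m) then mps_coeff f m else 0)"
      unfolding times_mps_def one_mps_def mps_coeff_Abs
      by (rule sum.cong) (auto split: if_splits)
    also have "\<dots> = mps_coeff f m"
      by (subst sum.delta) (auto simp: finite_exponent_splits)
    finally show "mps_coeff (1 * f) m = mps_coeff f m" .
  qed
  show "(f + g) * h = f * h + g * h"
    by (rule mps_eqI)
       (simp add: times_mps_def plus_mps_def case_prod_unfold sum.distrib algebra_simps)
  show "(0 :: 'a mps) \<noteq> 1"
    by (auto simp: zero_mps_def one_mps_def Abs_mps_inject fun_eq_iff intro!: exI[of _ 0])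
  show "f + g + h = f + (g + h)" "f + g = g + f" "0 + f = f" "- f + f = 0" "f - g = f + - g"
    by (auto intro!: mps_eqI simp: mps_ring_defs)
qed

end

definition mps_monom :: "('v \<Rightarrow>\<^sub>0 nat) \<Rightarrow> 'v mps" where
  "mps_monom p = Abs_mps (\<lambda>m. if m = p then 1 else 0)"

definition mps_var :: "'v \<Rightarrow> 'v mps" where
  "mps_var v = mps_monom (Poly_Mapping.single v 1)"

definition mps_const :: "complex \<Rightarrow> 'v mps" where
  "mps_const c = Abs_mps (\<lambda>m. if m = 0 then c else 0)"

text \<open>
  A family is summable if every monomial occurs in only finitely many members; its sum
  is then formed coefficientwise.
\<close>

definition mps_summable :: "('i \<Rightarrow> 'v mps) \<Rightarrow> 'i set \<Rightarrow> bool" where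
  "mps_summable F I \<longleftrightarrow> (\<forall>m. finite {i \<in> I. mps_coeff (F i) m \<noteq> 0})"

definition mps_infsum :: "('i \<Rightarrow> 'v mps) \<Rightarrow> 'i set \<Rightarrow> 'v mps" where
  "mps_infsum F I = Abs_mps (\<lambda>m. \<Sum>i\<in>{i \<in> I. mps_coeff (F i) m \<noteq> 0}. mps_coeff (F i) m)"

lemma mps_monom_mult: "mps_monom p * mps_monom q = mps_monom (p + q)"
proof (rule mps_eqI)
  fix m
  have "mps_coeff (mps_monom p * mps_monom q) m =
      (\<Sum>z\<in>{(r, s). r + s = m}. if z = (p, q) then 1 else 0)"
    unfolding times_mps_def mps_monom_def mps_coeff_Abs
    by (rule sum.cong) (auto split: if_splits)
  also have "\<dots> = mps_coeff (mps_monom (p + q)) m"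
    by (subst sum.delta) (auto simp: finite_exponent_splits mps_monom_def)
  finally show "mps_coeff (mps_monom p * mps_monom q) m = mps_coeff (mps_monom (p + q)) m" .
qed

lemma mps_var_power: "mps_var v ^ k = mps_monom (Poly_Mapping.single v k)"
  by (induction k)
     (simp_all add: mps_var_def mps_monom_mult single_add[symmetric],
      simp add: mps_monom_def one_mps_def)


section \<open>Symmetric functions\<close>

text \<open>
  The variable with index \<open>k\<close> of the polynomial ring stands for the power sum of degree \<open>k + 1\<close>.
\<close>

type_synonym symfun = "(nat \<Rightarrow>\<^sub>0 nat) \<Rightarrow>\<^sub>0 complex"

definition psum :: "nat \<Rightarrow> symfun" where
  "psum k = Poly_Mapping.single (Poly_Mapping.single (k - 1) 1) 1"

definition sym_const :: "complex \<Rightarrow> symfun" where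
  "sym_const c = Poly_Mapping.single 0 c"

text \<open>
  Series in \<open>u\<^sup>-\<^sup>1\<close> over the symmetric functions are \<^typ>\<open>symfun fps\<close> with
  \<open>u\<^sup>-\<^sup>1\<close> as \<^term>\<open>fps_X\<close>. The exponential series is spelled out because \<^const>\<open>fps_exp\<close>
  needs a field of coefficients.
\<close>

definition H_series :: "symfun fps" where
  "H_series = fps_compose (Abs_fps (\<lambda>k. sym_const (1 / fact k)))
     (Abs_fps (\<lambda>k. if k = 0 then 0 else sym_const (1 / of_nat k) * psum k))"

text \<open>Expansion of \<open>1 / (u - c)\<close> in powers of \<open>u\<^sup>-\<^sup>1\<close>.\<close>

definition inv_linear :: "complex \<Rightarrow> symfun fps" where
  "inv_linear c = fps_X * Abs_fps (\<lambda>k. sym_const (c ^ k))"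

lemma sym_const_mult: "sym_const c * sym_const d = sym_const (c * d)"
  by (simp add: sym_const_def mult_single)

lemma inv_linear_correct: "(1 - fps_const (sym_const c) * fps_X) * inv_linear c = fps_X"
proof -
  have "Abs_fps (\<lambda>k. sym_const (c ^ k)) =
      1 + fps_const (sym_const c) * (fps_X * Abs_fps (\<lambda>k. sym_const (c ^ k)))"
  proof (rule fps_ext)
    fix n
    show "fps_nth (Abs_fps (\<lambda>k. sym_const (c ^ k))) n =
      fps_nth (1 + fps_const (sym_const c) * (fps_X * Abs_fps (\<lambda>k. sym_const (c ^ k)))) n"
      by (cases n) (simp_all add: sym_const_mult, simp add: sym_const_def)
  qed
  then have "(1 - fps_const (sym_const c) * fps_X) * Abs_fps (\<lambda>k. sym_const (c ^ k)) = 1"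
    by (simp add: algebra_simps)
  then show ?thesis
    by (simp add: inv_linear_def mult.left_commute)
qed

definition inv_falling :: "(int \<Rightarrow> complex) \<Rightarrow> nat \<Rightarrow> symfun fps" where
  "inv_falling a k = (\<Prod>i = 1..k. inv_linear (a (int i)))"

definition hA_nat :: "(int \<Rightarrow> complex) \<Rightarrow> nat \<Rightarrow> symfun" where
  "hA_nat a = (THE g. g 0 = 1 \<and> (\<lambda>k. fps_const (g k) * inv_falling a k) sums H_series)"

definition hA :: "(int \<Rightarrow> complex) \<Rightarrow> int \<Rightarrow> symfun" where
  "hA a k = (if k < 0 then 0 else hA_nat a (nat k))"

lemma H_series_0: "fps_nth H_series 0 = 1"
  by (simp add: H_series_def fps_compose_nth sym_const_def)

lemma inv_falling_nth:
  "k \<ge> n \<Longrightarrow> fps_nth (inv_falling a k) n = (if n = k then 1 else 0)"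
proof (induction k arbitrary: n)
  case 0
  then show ?case by (simp add: inv_falling_def)
next
  case (Suc k)
  let ?G = "Abs_fps (\<lambda>j. sym_const (a (int (Suc k)) ^ j))"
  have rec: "inv_falling a (Suc k) = fps_X * (inv_falling a k * ?G)"
    by (simp add: inv_falling_def inv_linear_def mult.assoc mult.left_commute)
  show ?case
  proof (cases n)
    case 0
    then show ?thesis by (simp add: rec)
  next
    case (Suc j)
    with Suc.prems have "j \<le> k" by simp
    then have "fps_nth (inv_falling a k * ?G) j =
        (\<Sum>i = 0..j. if i = k then fps_nth ?G (j - i) else 0)"
      unfolding fps_mult_nth by (intro sum.cong) (auto simp: Suc.IH)
    also have "\<dots> = (if j = k then 1 else 0)"
      using \<open>j \<le> k\<close> by (auto simp: sum.delta sym_const_def)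
    finally show ?thesis using Suc by (simp add: rec)
  qed
qed

lemma inv_falling_sums_iff:
  "(\<lambda>k. fps_const (g k) * inv_falling a k) sums F \<longleftrightarrow>
   (\<forall>n. fps_nth F n = g n + (\<Sum>k<n. g k * fps_nth (inv_falling a k) n))"
proof -
  have part: "fps_nth (\<Sum>k<N. fps_const (g k) * inv_falling a k) n =
      g n + (\<Sum>k<n. g k * fps_nth (inv_falling a k) n)" if "N > n" for N n
  proof -
    have "fps_nth (\<Sum>k<N. fps_const (g k) * inv_falling a k) n =
        (\<Sum>k<N. g k * fps_nth (inv_falling a k) n)"
      by (simp add: fps_sum_nth)
    also have "\<dots> = (\<Sum>k<Suc n. g k * fps_nth (inv_falling a k) n)"
      using that by (intro sum.mono_neutral_right) (auto simp: inv_falling_nth)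
    finally show ?thesis by (simp add: inv_falling_nth add.commute)
  qed
  show ?thesis
    unfolding sums_def tendsto_fps_iff
  proof (rule iff_allI)
    fix n
    have ev: "\<forall>\<^sub>F N in sequentially. fps_nth (\<Sum>k<N. fps_const (g k) * inv_falling a k) n =
      g n + (\<Sum>k<n. g k * fps_nth (inv_falling a k) n)"
      using part by (intro eventually_sequentiallyI[of "Suc n"]) auto
    show "(\<forall>\<^sub>F N in sequentially. fps_nth (\<Sum>k<N. fps_const (g k) * inv_falling a k) n = fps_nth F n)
      \<longleftrightarrow> fps_nth F n = g n + (\<Sum>k<n. g k * fps_nth (inv_falling a k) n)" (is "?L \<longleftrightarrow> ?R")
    proof
      assume ?L
      with ev have "\<forall>\<^sub>F N::nat in sequentially. ?R" by eventually_elim simp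
      then show ?R by simp
    next
      assume ?R
      with ev show ?L by simp
    qed
  qed
qed

lemma hA_nat_ex1:
  "\<exists>!g. g 0 = 1 \<and> (\<lambda>k. fps_const (g k) * inv_falling a k) sums H_series"
proof (rule ex_ex1I)
  define R where "R = (\<lambda>(f :: nat \<Rightarrow> symfun) n.
    fps_nth H_series n - (\<Sum>k<n. f k * fps_nth (inv_falling a k) n))"
  define g where "g = wfrec less_than R"
  have "adm_wf less_than R"
    by (auto simp: adm_wf_def R_def intro!: sum.cong)
  then have g: "g n = R g n" for n
    unfolding g_def by (subst wfrec_fixpoint) auto
  have "g 0 = 1"
    by (subst g) (simp add: R_def H_series_0)
  moreover have "fps_nth H_series n = g n + (\<Sum>k<n. g k * fps_nth (inv_falling a k) n)" for n
    by (subst (1) g) (simp add: R_def)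
  ultimately show "\<exists>g. g 0 = 1 \<and> (\<lambda>k. fps_const (g k) * inv_falling a k) sums H_series"
    unfolding inv_falling_sums_iff by blast
next
  fix g g' :: "nat \<Rightarrow> symfun"
  assume g: "g 0 = 1 \<and> (\<lambda>k. fps_const (g k) * inv_falling a k) sums H_series"
    and g': "g' 0 = 1 \<and> (\<lambda>k. fps_const (g' k) * inv_falling a k) sums H_series"
  have "g n = g' n" for n
  proof (induction n rule: less_induct)
    case (less n)
    then have "(\<Sum>k<n. g k * fps_nth (inv_falling a k) n) =
        (\<Sum>k<n. g' k * fps_nth (inv_falling a k) n)"
      by (intro sum.cong) auto
    moreover have "g n + (\<Sum>k<n. g k * fps_nth (inv_falling a k) n) =
        g' n + (\<Sum>k<n. g' k * fps_nth (inv_falling a k) n)"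
      using g g' unfolding inv_falling_sums_iff by simp
    ultimately show ?case by simp
  qed
  then show "g = g'" by blast
qed

lemma hA_nat_0: "hA_nat a 0 = 1"
  and hA_nat_sums: "(\<lambda>k. fps_const (hA_nat a k) * inv_falling a k) sums H_series"
  using theI'[OF hA_nat_ex1[of a]] unfolding hA_nat_def by blast+

definition shift :: "int \<Rightarrow> (int \<Rightarrow> complex) \<Rightarrow> int \<Rightarrow> complex" where
  "shift r a = (\<lambda>i. a (i + r))"


section \<open>Young diagrams and multiparameter Schur functions\<close>

definition is_partition :: "nat list \<Rightarrow> bool" where
  "is_partition \<mu> \<longleftrightarrow> sorted_wrt (\<ge>) \<mu> \<and> (\<forall>k\<in>set \<mu>. k > 0)"

definition part :: "nat list \<Rightarrow> nat \<Rightarrow> nat" where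
  "part \<mu> i = (if 1 \<le> i \<and> i \<le> length \<mu> then \<mu> ! (i - 1) else 0)"

definition diagram :: "nat list \<Rightarrow> (nat \<times> nat) set" where
  "diagram \<mu> = {(i, j). 1 \<le> i \<and> 1 \<le> j \<and> j \<le> part \<mu> i}"

fun content :: "nat \<times> nat \<Rightarrow> int" where
  "content (i, j) = int j - int i"

text \<open>The determinant of order \<open>N\<close>; matrix indices start at \<open>0\<close>, hence the successors.\<close>

definition multi_schur :: "nat \<Rightarrow> nat list \<Rightarrow> (int \<Rightarrow> complex) \<Rightarrow> symfun" where
  "multi_schur N \<mu> a = det (mat N N (\<lambda>(r, c).
     let i = Suc r; j = Suc c
     in hA (shift (1 - int j) a) (int (part \<mu> i) - int i + int j)))"


section \<open>Supersymmetric evaluation\<close>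

definition super_psum :: "(nat \<Rightarrow> 'v mps) \<Rightarrow> (nat \<Rightarrow> 'v mps) \<Rightarrow> nat \<Rightarrow> 'v mps" where
  "super_psum x y k =
     mps_infsum (\<lambda>i. x i ^ k) {1..} + (- 1) ^ (k - 1) * mps_infsum (\<lambda>i. y i ^ k) {1..}"

definition super_eval :: "(nat \<Rightarrow> 'v mps) \<Rightarrow> (nat \<Rightarrow> 'v mps) \<Rightarrow> symfun \<Rightarrow> 'v mps" where
  "super_eval x y f =
     (\<Sum>m\<in>Poly_Mapping.keys f. mps_const (Poly_Mapping.lookup f m) *
        (\<Prod>k\<in>Poly_Mapping.keys m. super_psum x y (Suc k) ^ Poly_Mapping.lookup m k))"

type_synonym super_mps = "(nat + nat) mps"

definition xvar :: "nat \<Rightarrow> super_mps" where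
  "xvar i = mps_var (Inl i)"

definition yvar :: "nat \<Rightarrow> super_mps" where
  "yvar i = mps_var (Inr i)"

definition zero_above :: "nat \<Rightarrow> (nat \<Rightarrow> super_mps) \<Rightarrow> nat \<Rightarrow> super_mps" where
  "zero_above n z = (\<lambda>i. if i \<le> n then z i else 0)"

lemma summable_var_power:
  assumes "inj v" and "k > 0"
  shows "mps_summable (\<lambda>i. mps_var (v i) ^ k) I"
  unfolding mps_summable_def
proof
  fix m
  have "{i \<in> I. mps_coeff (mps_var (v i) ^ k) m \<noteq> 0} \<subseteq> v -` Poly_Mapping.keys m"
    using assms(2) by (auto simp: mps_var_power mps_monom_def split: if_splits)
  moreover have "finite (v -` Poly_Mapping.keys m)"
    using assms(1) by (simp add: finite_vimageI)
  ultimately show "finite {i \<in> I. mps_coeff (mps_var (v i) ^ k) m \<noteq> 0}"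
    by (rule finite_subset)
qed


section \<open>Diagonal-strict tableaux\<close>

text \<open>Tableaux are extensional functions, so that distinct functions are distinct tableaux.\<close>

definition weakly_increasing :: "(nat \<times> nat) set \<Rightarrow> (nat \<times> nat \<Rightarrow> 'b::linorder) \<Rightarrow> bool" where
  "weakly_increasing D T \<longleftrightarrow>
     (\<forall>i j j'. (i, j) \<in> D \<and> (i, j') \<in> D \<and> j \<le> j' \<longrightarrow> T (i, j) \<le> T (i, j')) \<and>
     (\<forall>i i' j. (i, j) \<in> D \<and> (i', j) \<in> D \<and> i \<le> i' \<longrightarrow> T (i, j) \<le> T (i', j))"

definition diagonal_strict_tableaux :: "nat list \<Rightarrow> (nat \<times> nat \<Rightarrow> nat) set" where
  "diagonal_strict_tableaux \<mu> =
     {T \<in> diagram \<mu> \<rightarrow>\<^sub>E {1..}. weakly_increasing (diagram \<mu>) T \<and>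
        (\<forall>s\<in>diagram \<mu>. \<forall>t\<in>diagram \<mu>.
           content s = content t \<and> fst s < fst t \<longrightarrow> T s < T t)}"

definition adjacency :: "(nat \<times> nat) set \<Rightarrow> ((nat \<times> nat) \<times> (nat \<times> nat)) set" where
  "adjacency \<nu> = {((i, j), (i', j')). (i, j) \<in> \<nu> \<and> (i', j') \<in> \<nu> \<and>
     (i = i' \<and> (j' = Suc j \<or> j = Suc j') \<or> j = j' \<and> (i' = Suc i \<or> i = Suc i'))}"

definition diagram_components :: "(nat \<times> nat) set \<Rightarrow> (nat \<times> nat) set set" where
  "diagram_components \<nu> = (\<lambda>s. (adjacency \<nu>)\<^sup>* `` {s}) ` \<nu>"

definition f_connected ::
    "(int \<Rightarrow> complex) \<Rightarrow> (nat \<times> nat) set \<Rightarrow> 'v mps \<Rightarrow> 'v mps \<Rightarrow> 'v mps" where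
  "f_connected a \<nu> u v = (u + v) *
     (\<Prod>(i, j)\<in>{(i, j). (i, j) \<in> \<nu> \<and> (i, Suc j) \<in> \<nu>}. u - mps_const (a (int j - int i + 1))) *
     (\<Prod>(i, j)\<in>{(i, j). (i, j) \<in> \<nu> \<and> (Suc i, j) \<in> \<nu>}. v + mps_const (a (int j - int i)))"

definition f_skew ::
    "(int \<Rightarrow> complex) \<Rightarrow> (nat \<times> nat) set \<Rightarrow> 'v mps \<Rightarrow> 'v mps \<Rightarrow> 'v mps" where
  "f_skew a \<nu> u v = (\<Prod>\<kappa>\<in>diagram_components \<nu>. f_connected a \<kappa> u v)"

text \<open>
  The product over all positive \<open>i\<close> is taken over the entries of the tableau only;
  the remaining fibres are empty and contribute the factor \<open>1\<close>.
\<close>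

definition diagonal_strict_weight ::
    "(int \<Rightarrow> complex) \<Rightarrow> nat list \<Rightarrow> (nat \<Rightarrow> 'v mps) \<Rightarrow> (nat \<Rightarrow> 'v mps) \<Rightarrow>
     (nat \<times> nat \<Rightarrow> nat) \<Rightarrow> 'v mps" where
  "diagonal_strict_weight a \<mu> x y T =
     (\<Prod>i\<in>T ` diagram \<mu>. f_skew a {s \<in> diagram \<mu>. T s = i} (x i) (y i))"

lemma f_skew_empty: "f_skew a {} u v = 1"
  by (simp add: f_skew_def diagram_components_def)


section \<open>Tableaux with primed and unprimed entries\<close>

datatype letter = Primed nat | Unprimed nat

fun letter_abs :: "letter \<Rightarrow> nat" where
  "letter_abs (Primed i) = i"
| "letter_abs (Unprimed i) = i"

text \<open>The rank realises the order \<open>1' < 1 < 2' < 2 < \<dots>\<close>.\<close>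

fun letter_rank :: "letter \<Rightarrow> nat" where
  "letter_rank (Primed i) = 2 * i"
| "letter_rank (Unprimed i) = 2 * i + 1"

lemma letter_rank_inject: "letter_rank s = letter_rank t \<longleftrightarrow> s = t"
  by (cases s; cases t) (auto, presburger+)

instantiation letter :: linorder
begin

definition "s \<le> t \<longleftrightarrow> letter_rank s \<le> letter_rank t"
definition "s < t \<longleftrightarrow> letter_rank s < letter_rank t"

instance
  by standard (auto simp: less_eq_letter_def less_letter_def letter_rank_inject[symmetric])

end

definition letters_upto :: "nat \<Rightarrow> letter set" where
  "letters_upto n = Primed ` {1..n} \<union> Unprimed ` {1..n}"

definition letter_tableaux :: "nat list \<Rightarrow> nat \<Rightarrow> (nat \<times> nat \<Rightarrow> letter) set" where
  "letter_tableaux \<mu> n =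
     {T \<in> diagram \<mu> \<rightarrow>\<^sub>E letters_upto n. weakly_increasing (diagram \<mu>) T \<and>
        (\<forall>k r. card {s \<in> diagram \<mu>. fst s = r \<and> T s = Primed k} \<le> 1) \<and>
        (\<forall>k c. card {s \<in> diagram \<mu>. snd s = c \<and> T s = Unprimed k} \<le> 1)}"

definition letter_weight ::
    "(int \<Rightarrow> complex) \<Rightarrow> nat list \<Rightarrow> nat \<Rightarrow> (nat \<Rightarrow> 'v mps) \<Rightarrow> (nat \<Rightarrow> 'v mps) \<Rightarrow>
     (nat \<times> nat \<Rightarrow> letter) \<Rightarrow> 'v mps" where
  "letter_weight a \<mu> n x y T =
     (\<Prod>s\<in>{s \<in> diagram \<mu>. T s \<in> Unprimed ` {1..n}}.
        x (letter_abs (T s)) - mps_const (a (content s))) *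
     (\<Prod>s\<in>{s \<in> diagram \<mu>. T s \<in> Primed ` {1..n}}.
        y (letter_abs (T s)) + mps_const (a (content s)))"

end

theory Submission
  imports Defs
begin

text \<open>
  Both tableau formulas come from peeling off one pair of variables \<open>(x, y) = (x\<^sub>n, y\<^sub>n)\<close> at a time.
  Put \<open>\<phi>\<^sub>l = \<Prod>\<^bsub>k \<le> l\<^esub> (u - a\<^sub>k)\<close>, where only ratios of such products matter. If \<open>G\<close> is the generating
  series \<open>H(u)\<close> in some variables, then the expansion \<open>G / \<phi>\<^bsub>-j\<^esub> = \<Sum>\<^sub>l M(l, j) / \<phi>\<^sub>l\<close> has as coefficient
  \<open>M(l, j)\<close> the element \<open>h\<^bsub>l+j;b\<^esub>\<close> with \<open>b\<close> the sequence \<open>a\<close> shifted by \<open>-j\<close>. The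
  determinant defining the Schur function of \<open>\<mu>\<close> is therefore the minor of \<open>M\<close> with rows \<open>\<mu>\<^bsub>i+1\<^esub> - i\<close> and columns \<open>j\<close>, for \<open>0 \<le> i, j < N\<close>; this is \<open>beta_det\<close>.

  Adjoining the pair multiplies \<open>H(u)\<close> by \<open>(u + y) / (u - x)\<close>. Compared in the basis \<open>1 / \<phi>\<^sub>l\<close>, this says
  that the new matrix \<open>M'\<close> is obtained from \<open>M\<close> in two steps through an intermediate matrix \<open>Y\<close>:
  \<open>Y(l) = M(l) + (y + a\<^bsub>l-1\<^esub>) M(l-1)\<close> and \<open>M'(l) = Y(l) + (x - a\<^bsub>l-1\<^esub>) M'(l-1)\<close>
  (\<open>hA_adjoin_pair\<close>). Each step acts on rows, so a minor expands by multilinearity. In the first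
  step every row is kept or lowered by one, and the surviving terms are the vertical strips
  (\<open>beta_det_vertical\<close>). In the second step, after subtracting from each row a multiple of the next
  one, every row index ranges over an interval that stops just before the next row; these are the horizontal strips
  (\<open>beta_det_horizontal\<close>). The index \<open>l - 1\<close> of a lowered row is the content of the removed square, so the
  weights are exactly those of primed and unprimed letters. An \<open>\<bbbA>\<close>-tableau is the same as
  a chain of such strips, whence the second formula (\<open>sum_tableaux_insert\<close>,
  \<open>schur_eq_sum_tableaux_over\<close>).

  The first formula for finitely many variables is obtained by grouping the letter tableaux \<open>T\<close> by
  \<open>|T|\<close>, which is diagonal-strict. Within a fibre of \<open>|T|\<close> a square with a left neighbour in the
  fibre must be unprimed and a square with a lower neighbour must be primed. A
  connected component has exactly one square with neither (\<open>component_unique_root\<close>); its letter is free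
  and contributes \<open>(x - a\<^sub>c) + (y + a\<^sub>c) = x + y\<close>. This is the shape of \<open>f\<^bsub>\<nu>;a\<^esub>\<close>.

  For infinitely many variables, setting all variables of index larger than \<open>n\<close> to zero is a ring homomorphism
  \<open>truncate n\<close> which does not change a given coefficient once \<open>n\<close> is large.
\<close>

section \<open>Expanding determinants along strips\<close>

lemma det_expand_rows:
  fixes c :: "nat \<Rightarrow> 'k \<Rightarrow> 'a::comm_ring_1" and B :: "'k \<Rightarrow> nat \<Rightarrow> 'a"
  assumes fin: "\<And>i. i < N \<Longrightarrow> finite (S i)"
  shows "det (mat N N (\<lambda>(i, j). \<Sum>k\<in>S i. c i k * B k j)) =
    (\<Sum>f\<in>Pi\<^sub>E {..<N} S. (\<Prod>i<N. c i (f i)) * det (mat N N (\<lambda>(i, j). B (f i) j)))"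
proof -
  have perm: "p i < N" if "p permutes {..<N}" "i < N" for p i
    using that by (metis lessThan_iff permutes_in_image)
  have det_mat: "det (mat N N (\<lambda>(i, j). A i j)) =
      (\<Sum>p | p permutes {..<N}. signof p * (\<Prod>i<N. A i (p i)))" for A :: "nat \<Rightarrow> nat \<Rightarrow> 'a"
    by (subst det_def'[of _ N]) (auto simp: atLeast0LessThan perm intro!: sum.cong prod.cong)
  have "det (mat N N (\<lambda>(i, j). \<Sum>k\<in>S i. c i k * B k j)) =
     (\<Sum>p | p permutes {..<N}. signof p * (\<Sum>f\<in>Pi\<^sub>E {..<N} S. \<Prod>i<N. c i (f i) * B (f i) (p i)))"
    unfolding det_mat using fin by (intro sum.cong refl arg_cong2[where f = "(*)"] prod_sum_PiE) auto
  also have "\<dots> = (\<Sum>f\<in>Pi\<^sub>E {..<N} S. \<Sum>p | p permutes {..<N}.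
      signof p * (\<Prod>i<N. c i (f i) * B (f i) (p i)))"
    by (simp add: sum_distrib_left) (rule sum.swap)
  also have "\<dots> = (\<Sum>f\<in>Pi\<^sub>E {..<N} S. (\<Prod>i<N. c i (f i)) * det (mat N N (\<lambda>(i, j). B (f i) j)))"
    unfolding det_mat by (simp add: sum_distrib_left prod.distrib algebra_simps)
  finally show ?thesis .
qed

text \<open>
  Row lengths indexed from \<open>1\<close>, as in \<open>part\<close>; the value at \<open>0\<close> is pinned to \<open>0\<close> so that distinct
  functions have distinct diagrams.
\<close>

definition shapes :: "nat \<Rightarrow> (nat \<Rightarrow> nat) set" where
  "shapes N = {p. p 0 = 0 \<and> (\<forall>i>N. p i = 0) \<and> (\<forall>i\<ge>1. p (Suc i) \<le> p i)}"

definition squares :: "(nat \<Rightarrow> nat) \<Rightarrow> (nat \<times> nat) set" where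
  "squares p = {(i, j). 1 \<le> i \<and> 1 \<le> j \<and> j \<le> p i}"

text \<open>The rows are selected by the beta-numbers \<open>p\<^bsub>i+1\<^esub> - i\<close> of the shape, a strictly decreasing sequence.\<close>

definition beta_det :: "nat \<Rightarrow> (int \<Rightarrow> nat \<Rightarrow> 'a::comm_ring_1) \<Rightarrow> (nat \<Rightarrow> nat) \<Rightarrow> 'a" where
  "beta_det N M p = det (mat N N (\<lambda>(i, j). M (int (p (Suc i)) - int i) j))"

definition vertical_below :: "(nat \<Rightarrow> nat) \<Rightarrow> (nat \<Rightarrow> nat) set" where
  "vertical_below p = {q. (\<forall>i. q i \<le> p i \<and> p i \<le> Suc (q i)) \<and> (\<forall>i\<ge>1. q (Suc i) \<le> q i)}"

definition horizontal_below :: "(nat \<Rightarrow> nat) \<Rightarrow> (nat \<Rightarrow> nat) set" where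
  "horizontal_below p = {q. q 0 = 0 \<and> (\<forall>i\<ge>1. q i \<le> p i \<and> p (Suc i) \<le> q i)}"

lemma squares_eq_Sigma:
  assumes "p \<in> shapes N"
  shows "squares p = Sigma {1..N} (\<lambda>i. {1..p i})"
proof -
  have "i \<le> N" if "Suc 0 \<le> j" "j \<le> p i" for i j
    using assms that by (cases "i \<le> N") (auto simp: shapes_def)
  then show ?thesis by (auto simp: squares_def)
qed

lemma finite_squares: "p \<in> shapes N \<Longrightarrow> finite (squares p)"
  by (simp add: squares_eq_Sigma)

lemma vertical_below_shapes:
  assumes "p \<in> shapes N" "q \<in> vertical_below p" shows "q \<in> shapes N"
proof -
  have le: "q i \<le> p i" for i using assms(2) by (simp add: vertical_below_def)
  have "q i = 0" if "p i = 0" for i using le[of i] that by simp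
  then show ?thesis using assms by (simp add: shapes_def vertical_below_def)
qed

lemma horizontal_below_shapes:
  assumes "p \<in> shapes N" "q \<in> horizontal_below p" shows "q \<in> shapes N"
proof -
  have le: "q i \<le> p i" "p (Suc i) \<le> q i" if "1 \<le> i" for i
    using assms(2) that by (simp_all add: horizontal_below_def)
  have "q (Suc i) \<le> q i" if "1 \<le> i" for i
    using le(1)[of "Suc i"] le(2)[OF that] by simp
  moreover have "q i = 0" if "N < i" for i
    using le(1)[of i] that assms(1) by (simp add: shapes_def)
  ultimately show ?thesis using assms(2) by (simp add: shapes_def horizontal_below_def)
qed

text \<open>
  The squares removed from a row when its beta-number drops from \<open>m\<close> to \<open>l\<close> have the contents
  \<open>l, \<dots>, m - 1\<close>. This is what turns weights of lowered rows into weights of squares.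
\<close>

lemma prod_removed_squares:
  fixes g :: "int \<Rightarrow> 'a::comm_monoid_mult"
  assumes "p \<in> shapes N" "\<And>i. q i \<le> p i"
  shows "(\<Prod>s\<in>squares p - squares q. g (content s)) =
    (\<Prod>i<N. \<Prod>t\<in>{int (q (Suc i)) - int i..<int (p (Suc i)) - int i}. g t)"
proof -
  have "squares p - squares q = Sigma {1..N} (\<lambda>i. {q i<..p i})"
    using assms(2) unfolding squares_eq_Sigma[OF assms(1)] by (auto simp: squares_def)
  then have "(\<Prod>s\<in>squares p - squares q. g (content s)) =
      (\<Prod>i\<in>{1..N}. \<Prod>j\<in>{q i<..p i}. g (int j - int i))"
    by (subst prod.Sigma) (auto intro!: prod.cong)
  also have "\<dots> = (\<Prod>i<N. \<Prod>j\<in>{q (Suc i)<..p (Suc i)}. g (int j - int (Suc i)))"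
    by (rule prod.reindex_bij_witness[of _ Suc "\<lambda>i. i - 1"]) auto
  also have "\<dots> = (\<Prod>i<N. \<Prod>t\<in>{int (q (Suc i)) - int i..<int (p (Suc i)) - int i}. g t)"
  proof (rule prod.cong)
    fix i assume "i \<in> {..<N}"
    show "(\<Prod>j\<in>{q (Suc i)<..p (Suc i)}. g (int j - int (Suc i))) =
      (\<Prod>t\<in>{int (q (Suc i)) - int i..<int (p (Suc i)) - int i}. g t)"
      by (rule prod.reindex_bij_witness[of _ "\<lambda>t. nat (t + int (Suc i))" "\<lambda>j. int j - int (Suc i)"]) auto
  qed simp
  finally show ?thesis .
qed

lemma det_zero_row:
  assumes "i < N" "\<And>j. j < N \<Longrightarrow> A i j = (0::'a::comm_ring_1)"
  shows "det (mat N N (\<lambda>(i, j). A i j)) = 0"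
proof -
  have "(\<Prod>k = 0..<N. mat N N (\<lambda>(i, j). A i j) $$ (k, p k)) = 0" if "p permutes {0..<N}" for p
  proof -
    have "p k < N" if "k < N" for k
      using \<open>p permutes {0..<N}\<close> that permutes_in_image[of p "{0..<N}" k] by simp
    with assms show ?thesis by (intro prod_zero bexI[of _ i]) auto
  qed
  then show ?thesis by (subst det_def'[of _ N]) simp_all
qed

lemma det_equal_rows:
  assumes "i < N" "k < N" "i \<noteq> k" "\<And>j. A i j = A k j"
  shows "det (mat N N (\<lambda>(i, j). A i j)) = (0::'a::comm_ring_1)"
  by (rule det_identical_rows[of _ N i k]) (use assms in \<open>auto simp: row_def\<close>)

definition beta_numbers :: "nat \<Rightarrow> (nat \<Rightarrow> nat) \<Rightarrow> nat \<Rightarrow> int" where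
  "beta_numbers N q = (\<lambda>i\<in>{..<N}. int (q (Suc i)) - int i)"

text \<open>The inverse of \<open>beta_numbers\<close>, meaningful for entries with \<open>f i \<ge> - i\<close>.\<close>

definition shape_of_beta :: "nat \<Rightarrow> (nat \<Rightarrow> int) \<Rightarrow> nat \<Rightarrow> nat" where
  "shape_of_beta N f i = (if 1 \<le> i \<and> i \<le> N then nat (f (i - 1) + int (i - 1)) else 0)"

lemma shape_of_beta_numbers:
  assumes "q \<in> shapes N" shows "shape_of_beta N (beta_numbers N q) = q"
proof
  fix i show "shape_of_beta N (beta_numbers N q) i = q i"
    using assms by (cases i) (auto simp: shapes_def shape_of_beta_def beta_numbers_def)
qed

lemma shape_of_beta_Suc:
  "i < N \<Longrightarrow> - int i \<le> f i \<Longrightarrow> int (shape_of_beta N f (Suc i)) = f i + int i"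
  by (simp add: shape_of_beta_def)

lemma beta_numbers_of_shape:
  assumes "f \<in> extensional {..<N}" "\<And>i. i < N \<Longrightarrow> - int i \<le> f i"
  shows "beta_numbers N (shape_of_beta N f) = f"
  using assms by (auto simp: fun_eq_iff beta_numbers_def shape_of_beta_Suc extensional_def)

lemma beta_det_shape_of_beta:
  assumes "\<And>i. i < N \<Longrightarrow> - int i \<le> f i"
  shows "beta_det N M (shape_of_beta N f) = det (mat N N (\<lambda>(i, j). M (f i) j))"
  unfolding beta_det_def using assms
  by (intro arg_cong[where f = det] cong_mat) (auto simp: shape_of_beta_Suc)

text \<open>
  Every row of \<open>Y\<close> is a sum of two rows of \<open>M\<close>, so the determinant splits into one term for each set of
  rows to be lowered by one. Since the beta-numbers decrease strictly, a choice that fails to decrease makes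
  two rows equal, and a choice leaving the range of shapes ends in a zero row. The remaining choices are
  the vertical strips.
\<close>

lemma beta_det_vertical:
  fixes M Y :: "int \<Rightarrow> nat \<Rightarrow> 'a::comm_ring_1" and v :: "int \<Rightarrow> 'a"
  assumes p: "p \<in> shapes N"
    and M0: "\<And>l j. j < N \<Longrightarrow> l < - int j \<Longrightarrow> M l j = 0"
    and Y: "\<And>l j. j < N \<Longrightarrow> Y l j = M l j + v (l - 1) * M (l - 1) j"
  shows "beta_det N Y p =
    (\<Sum>q\<in>vertical_below p. (\<Prod>s\<in>squares p - squares q. v (content s)) * beta_det N M q)"
proof -
  define l where "l i = int (p (Suc i)) - int i" for i
  define S where "S i = {l i - 1, l i}" for i
  \<comment> \<open>the weight of a lowered row \<open>l i\<close> is \<open>v (l i - 1)\<close>, which is \<open>v\<close> at the new index\<close>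
  define c where "c i k = (if k = l i then 1 else v k)" for i k
  define good where "good f \<longleftrightarrow> (\<forall>i<N. - int i \<le> f i) \<and> (\<forall>i. Suc i < N \<longrightarrow> f (Suc i) < f i)"
    for f :: "nat \<Rightarrow> int"
  let ?D = "\<lambda>f. det (mat N N (\<lambda>(i, j). M (f i) j))"
  have l_step: "l (Suc i) \<le> l i - 1" for i
  proof -
    have "p (Suc (Suc i)) \<le> p (Suc i)" using p by (simp add: shapes_def)
    then show ?thesis by (simp add: l_def)
  qed
  have l_low: "- int i \<le> l i" for i by (simp add: l_def)
  have fS: "f i = l i \<or> f i = l i - 1" if "f \<in> Pi\<^sub>E {..<N} S" "i < N" for f i
    using PiE_mem[OF that(1), of i] that(2) by (auto simp: S_def)
  have bad: "?D f = 0" if f: "f \<in> Pi\<^sub>E {..<N} S" and ng: "\<not> good f" for f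
  proof (cases "\<exists>i. Suc i < N \<and> f i \<le> f (Suc i)")
    case True
    then obtain i where i: "Suc i < N" "f i \<le> f (Suc i)" by blast
    then have "f i = f (Suc i)" using fS[OF f, of i] fS[OF f, of "Suc i"] l_step[of i] by auto
    then show ?thesis using i by (intro det_equal_rows[of i _ "Suc i"]) auto
  next
    case False
    then have dec: "f (Suc i) < f i" if "Suc i < N" for i using that by (meson not_le)
    with ng obtain i where i: "i < N" "f i < - int i" unfolding good_def by (meson not_le)
    \<comment> \<open>strict decrease passes the deficit on to the last row, all of whose entries then vanish\<close>
    have "i \<le> k \<Longrightarrow> k < N \<Longrightarrow> f k < - int k" for k
    proof (induction k rule: dec_induct)
      case base show ?case by (rule i)
    next
      case (step k) then show ?case using dec[of k] by simp
    qed
    from this[of "N - 1"] i have "f (N - 1) < - int (N - 1)" by simp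
    then show ?thesis using i(1) by (intro det_zero_row[of "N - 1"] M0) auto
  qed
  have "beta_det N Y p = det (mat N N (\<lambda>(i, j). \<Sum>k\<in>S i. c i k * M k j))"
    unfolding beta_det_def
    by (intro arg_cong[where f = det] cong_mat) (auto simp: Y S_def c_def l_def)
  also have "\<dots> = (\<Sum>f\<in>Pi\<^sub>E {..<N} S. (\<Prod>i<N. c i (f i)) * ?D f)"
    by (rule det_expand_rows) (simp add: S_def)
  also have "\<dots> = (\<Sum>f\<in>{f \<in> Pi\<^sub>E {..<N} S. good f}. (\<Prod>i<N. c i (f i)) * ?D f)"
  proof (rule sum.mono_neutral_right)
    show "finite (Pi\<^sub>E {..<N} S)" by (intro finite_PiE) (auto simp: S_def)
  qed (use bad in auto)
  also have "\<dots> = (\<Sum>q\<in>vertical_below p. (\<Prod>s\<in>squares p - squares q. v (content s)) * beta_det N M q)"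
  proof (rule sum.reindex_bij_witness[where i = "beta_numbers N" and j = "shape_of_beta N"])
    fix f assume "f \<in> {f \<in> Pi\<^sub>E {..<N} S. good f}"
    then have fP: "f \<in> Pi\<^sub>E {..<N} S" and g: "good f" by auto
    have f_low: "- int i \<le> f i" if "i < N" for i
      using g that by (simp add: good_def)
    define q where "q = shape_of_beta N f"
    have qf: "int (q (Suc i)) = f i + int i" if "i < N" for i
      using that f_low by (simp add: q_def shape_of_beta_Suc)
    have q0: "q i = 0" if "i = 0 \<or> N < i" for i using that by (auto simp: q_def shape_of_beta_def)
    have q1: "q i \<le> p i \<and> p i \<le> Suc (q i)" for i
    proof (cases "1 \<le> i \<and> i \<le> N")
      case True
      then obtain k where k: "i = Suc k" "k < N" by (cases i) auto
      with qf[of k] fS[OF fP, of k] show ?thesis by (auto simp: l_def)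
    next
      case False
      then have "i = 0 \<or> N < i" by auto
      with p q0[of i] show ?thesis by (auto simp: shapes_def)
    qed
    have q2: "q (Suc i) \<le> q i" if "1 \<le> i" for i
    proof (cases "Suc i \<le> N")
      case True
      with that obtain k where k: "i = Suc k" "Suc k < N" by (cases i) auto
      with g have "f (Suc k) < f k" by (simp add: good_def)
      with qf[of k] qf[of "Suc k"] k show ?thesis by simp
    qed (simp add: q0)
    show "beta_numbers N (shape_of_beta N f) = f"
      using fP f_low by (intro beta_numbers_of_shape) (auto simp: PiE_def)
    show "shape_of_beta N f \<in> vertical_below p"
      using q1 q2 unfolding q_def[symmetric] vertical_below_def by simp
    have "(\<Prod>s\<in>squares p - squares q. v (content s)) = (\<Prod>i<N. c i (f i))"
    proof (subst prod_removed_squares[OF p])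
      show "q i \<le> p i" for i using q1 by simp
      show "(\<Prod>i<N. prod v {int (q (Suc i)) - int i..<int (p (Suc i)) - int i}) = (\<Prod>i<N. c i (f i))"
      proof (rule prod.cong)
        fix i assume "i \<in> {..<N}"
        then have i: "i < N" by simp
        from fS[OF fP i] show "prod v {int (q (Suc i)) - int i..<int (p (Suc i)) - int i} = c i (f i)"
        proof
          assume "f i = l i" then show ?thesis using qf[OF i] by (simp add: c_def l_def)
        next
          assume *: "f i = l i - 1"
          then have "{int (q (Suc i)) - int i..<int (p (Suc i)) - int i} = {f i}"
            using qf[OF i] by (auto simp: l_def)
          then show ?thesis using * by (simp add: c_def)
        qed
      qed simp
    qed
    then show "(\<Prod>s\<in>squares p - squares (shape_of_beta N f). v (content s)) *
        beta_det N M (shape_of_beta N f) = (\<Prod>i<N. c i (f i)) * ?D f"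
      using f_low by (simp add: q_def beta_det_shape_of_beta)
  next
    fix q assume q: "q \<in> vertical_below p"
    from vertical_below_shapes[OF p q] have qs: "q \<in> shapes N" .
    then show "shape_of_beta N (beta_numbers N q) = q" by (rule shape_of_beta_numbers)
    have "beta_numbers N q i \<in> S i" if "i < N" for i
    proof -
      have "q (Suc i) \<le> p (Suc i) \<and> p (Suc i) \<le> Suc (q (Suc i))" using q by (simp add: vertical_below_def)
      then show ?thesis using that by (auto simp: S_def l_def beta_numbers_def)
    qed
    moreover have "good (beta_numbers N q)"
    proof -
      have "int (q (Suc (Suc i))) - int (Suc i) < int (q (Suc i)) - int i" for i
      proof -
        have "q (Suc (Suc i)) \<le> q (Suc i)" using qs by (simp add: shapes_def)
        then show ?thesis by simp
      qed
      then show ?thesis by (simp add: good_def beta_numbers_def)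
    qed
    ultimately show "beta_numbers N q \<in> {f \<in> Pi\<^sub>E {..<N} S. good f}"
      by (auto simp: beta_numbers_def)
  qed
  finally show ?thesis .
qed

lemma row_recurrence_iterate:
  fixes R Y :: "int \<Rightarrow> 'a::comm_ring_1" and v :: "int \<Rightarrow> 'a"
  assumes "\<And>l. R l = Y l + v (l - 1) * R (l - 1)" and "m \<le> l"
  shows "R l = (\<Sum>k\<in>{m<..l}. (\<Prod>t\<in>{k..<l}. v t) * Y k) + (\<Prod>t\<in>{m..<l}. v t) * R m"
  using assms(2)
proof (induction l rule: int_ge_induct)
  case base then show ?case by simp
next
  case (step l)
  have ext: "(\<Prod>t\<in>{k..<l + 1}. v t) = (\<Prod>t\<in>{k..<l}. v t) * v l" if "k \<le> l" for k
  proof -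
    have "{k..<l + 1} = insert l {k..<l}" using that by auto
    then show ?thesis by (simp add: mult.commute)
  qed
  have "{m<..l + 1} = insert (l + 1) {m<..l}" using step.hyps by auto
  then have "(\<Sum>k\<in>{m<..l + 1}. (\<Prod>t\<in>{k..<l + 1}. v t) * Y k) =
      Y (l + 1) + (\<Sum>k\<in>{m<..l}. (\<Prod>t\<in>{k..<l + 1}. v t) * Y k)" by simp
  also have "(\<Sum>k\<in>{m<..l}. (\<Prod>t\<in>{k..<l + 1}. v t) * Y k) =
      v l * (\<Sum>k\<in>{m<..l}. (\<Prod>t\<in>{k..<l}. v t) * Y k)"
    unfolding sum_distrib_left by (intro sum.cong) (auto simp: ext)
  finally show ?case
    using assms(1)[of "l + 1"] step.IH step.hyps ext[of m] by (simp add: algebra_simps)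
qed

text \<open>
  All subtractions happen simultaneously: they amount to multiplication by a unitriangular matrix.
\<close>

lemma det_subtract_next_row:
  fixes A :: "nat \<Rightarrow> nat \<Rightarrow> 'a::comm_ring_1"
  assumes "\<And>j. j < N \<Longrightarrow> A N j = 0"
  shows "det (mat N N (\<lambda>(i, j). A i j - w i * A (Suc i) j)) = det (mat N N (\<lambda>(i, j). A i j))"
proof -
  define U where "U = mat N N (\<lambda>(i, k). if k = i then 1 else if k = Suc i then - w i else (0::'a))"
  have "det U = 1"
    by (subst det_upper_triangular[of _ N])
       (auto simp: U_def upper_triangular_def prod_list_diag_prod)
  moreover have "mat N N (\<lambda>(i, j). A i j - w i * A (Suc i) j) = U * mat N N (\<lambda>(i, j). A i j)"
  proof (rule eq_matI)
    fix i j assume "i < dim_row (U * mat N N (\<lambda>(i, j). A i j))" "j < dim_col (U * mat N N (\<lambda>(i, j). A i j))"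
    then have ij: "i < N" "j < N" by (auto simp: U_def)
    have "(U * mat N N (\<lambda>(i, j). A i j)) $$ (i, j) =
        (\<Sum>k = 0..<N. (if k = i then A k j else 0) + (if k = Suc i then - w i * A k j else 0))"
      using ij by (auto simp: U_def scalar_prod_def intro!: sum.cong)
    also have "\<dots> = A i j - w i * A (Suc i) j"
      using ij assms[of j] by (cases "Suc i = N") (auto simp: sum.distrib)
    finally show "mat N N (\<lambda>(i, j). A i j - w i * A (Suc i) j) $$ (i, j) = (U * mat N N (\<lambda>(i, j). A i j)) $$ (i, j)"
      using ij by simp
  qed (auto simp: U_def)
  ultimately show ?thesis
    by (subst \<open>mat N N _ = U * _\<close>, subst det_mult[of _ N]) (auto simp: U_def)
qed

text \<open>
  The recurrence makes each row of \<open>R\<close> a combination of all lower rows of \<open>Y\<close>. Iterated only down to the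
  next beta-number, it leaves a multiple of the next row of the determinant, which row operations remove.
  The rows that remain range over disjoint intervals between consecutive beta-numbers, so that no
  term degenerates: the choices are precisely the horizontal strips.
\<close>

lemma beta_det_horizontal:
  fixes R Y :: "int \<Rightarrow> nat \<Rightarrow> 'a::comm_ring_1" and v :: "int \<Rightarrow> 'a"
  assumes p: "p \<in> shapes N"
    and R0: "\<And>l j. j < N \<Longrightarrow> l < - int j \<Longrightarrow> R l j = 0"
    and R: "\<And>l j. j < N \<Longrightarrow> R l j = Y l j + v (l - 1) * R (l - 1) j"
  shows "beta_det N R p =
    (\<Sum>q\<in>horizontal_below p. (\<Prod>s\<in>squares p - squares q. v (content s)) * beta_det N Y q)"
proof -
  define l where "l i = int (p (Suc i)) - int i" for i
  define S where "S i = {l (Suc i)<..l i}" for i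
  define w where "w k m = (\<Prod>t\<in>{k..<m}. v t)" for k m
  have l_step: "l (Suc i) \<le> l i" for i
  proof -
    have "p (Suc (Suc i)) \<le> p (Suc i)" using p by (simp add: shapes_def)
    then show ?thesis by (simp add: l_def)
  qed
  \<comment> \<open>the beta-number after the last one: the corresponding row of \<open>R\<close> vanishes in all columns\<close>
  have lN: "l N = - int N" using p by (simp add: l_def shapes_def)
  have "beta_det N R p = det (mat N N (\<lambda>(i, j). R (l i) j - w (l (Suc i)) (l i) * R (l (Suc i)) j))"
    unfolding beta_det_def l_def[symmetric]
    by (rule det_subtract_next_row[symmetric]) (auto simp: lN R0)
  also have "\<dots> = det (mat N N (\<lambda>(i, j). \<Sum>k\<in>S i. w k (l i) * Y k j))"
  proof (intro arg_cong[where f = det] cong_mat)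
    fix i j assume ij: "i < N" "j < N"
    have "R (l i) j = (\<Sum>k\<in>S i. w k (l i) * Y k j) + w (l (Suc i)) (l i) * R (l (Suc i)) j"
      unfolding S_def w_def by (rule row_recurrence_iterate[of "\<lambda>l. R l j" "\<lambda>l. Y l j" v, OF R[OF ij(2)] l_step])
    then show "(case (i, j) of (i, j) \<Rightarrow> R (l i) j - w (l (Suc i)) (l i) * R (l (Suc i)) j) =
        (case (i, j) of (i, j) \<Rightarrow> \<Sum>k\<in>S i. w k (l i) * Y k j)"
      by simp
  qed simp_all
  also have "\<dots> = (\<Sum>f\<in>Pi\<^sub>E {..<N} S. (\<Prod>i<N. w (f i) (l i)) * det (mat N N (\<lambda>(i, j). Y (f i) j)))"
    by (rule det_expand_rows) (simp add: S_def)
  also have "\<dots> = (\<Sum>q\<in>horizontal_below p. (\<Prod>s\<in>squares p - squares q. v (content s)) * beta_det N Y q)"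
  proof (rule sum.reindex_bij_witness[where i = "beta_numbers N" and j = "shape_of_beta N"])
    fix f assume f: "f \<in> Pi\<^sub>E {..<N} S"
    define q where "q = shape_of_beta N f"
    have fS: "l (Suc i) < f i" "f i \<le> l i" if "i < N" for i
      using PiE_mem[OF f, of i] that by (auto simp: S_def)
    have f_low: "- int i \<le> f i" if "i < N" for i
      using fS(1)[OF that] by (simp add: l_def)
    have qf: "int (q (Suc i)) = f i + int i" if "i < N" for i
      using that f_low by (simp add: q_def shape_of_beta_Suc)
    have q0: "q 0 = 0" by (simp add: q_def shape_of_beta_def)
    have q1: "q i \<le> p i \<and> p (Suc i) \<le> q i" if "1 \<le> i" for i
    proof (cases "i \<le> N")
      case True
      with that obtain k where k: "i = Suc k" "k < N" by (cases i) auto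
      with qf[of k] fS[of k] show ?thesis by (auto simp: l_def)
    next
      case False with p show ?thesis by (auto simp: q_def shape_of_beta_def shapes_def)
    qed
    show "beta_numbers N (shape_of_beta N f) = f"
      using f f_low by (intro beta_numbers_of_shape) (auto simp: PiE_def)
    show "shape_of_beta N f \<in> horizontal_below p"
      using q0 q1 unfolding q_def[symmetric] horizontal_below_def by simp
    have "(\<Prod>s\<in>squares p - squares q. v (content s)) = (\<Prod>i<N. w (f i) (l i))"
    proof (subst prod_removed_squares[OF p])
      show "q i \<le> p i" for i using q0 q1[of i] by (cases i) auto
      show "(\<Prod>i<N. prod v {int (q (Suc i)) - int i..<int (p (Suc i)) - int i}) = (\<Prod>i<N. w (f i) (l i))"
        by (intro prod.cong) (auto simp: w_def l_def qf)
    qed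
    then show "(\<Prod>s\<in>squares p - squares (shape_of_beta N f). v (content s)) * beta_det N Y (shape_of_beta N f) =
        (\<Prod>i<N. w (f i) (l i)) * det (mat N N (\<lambda>(i, j). Y (f i) j))"
      using f_low by (simp add: q_def beta_det_shape_of_beta)
  next
    fix q assume q: "q \<in> horizontal_below p"
    from horizontal_below_shapes[OF p q] have "q \<in> shapes N" .
    then show "shape_of_beta N (beta_numbers N q) = q" by (rule shape_of_beta_numbers)
    have "beta_numbers N q i \<in> S i" if "i < N" for i
    proof -
      have "q (Suc i) \<le> p (Suc i) \<and> p (Suc (Suc i)) \<le> q (Suc i)" using q by (simp add: horizontal_below_def)
      then show ?thesis using that by (auto simp: S_def l_def beta_numbers_def)
    qed
    then show "beta_numbers N q \<in> Pi\<^sub>E {..<N} S"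
      by (auto simp: beta_numbers_def)
  qed
  finally show ?thesis .
qed

section \<open>Supersymmetric evaluation as a ring homomorphism\<close>

lemma mps_coeff_const_mult: "mps_coeff (mps_const c * f) m = c * mps_coeff f m"
proof -
  have "mps_coeff (mps_const c * f) m =
      (\<Sum>z\<in>{(p, q). p + q = m}. if z = (0, m) then c * mps_coeff f m else 0)"
    unfolding times_mps_def mps_const_def mps_coeff_Abs
    by (rule sum.cong) (auto split: if_splits)
  also have "\<dots> = c * mps_coeff f m"
    by (subst sum.delta) (auto simp: finite_exponent_splits)
  finally show ?thesis .
qed

lemma mps_const_hom:
  "mps_const 0 = 0" "mps_const 1 = 1"
  "mps_const (c + d) = mps_const c + mps_const d" "mps_const (c * d) = mps_const c * mps_const d"
proof -
  show "mps_const 0 = 0" "mps_const 1 = 1" "mps_const (c + d) = mps_const c + mps_const d"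
    by (rule mps_eqI, simp add: mps_const_def mps_ring_defs)+
  show "mps_const (c * d) = mps_const c * mps_const d"
    by (rule mps_eqI, simp only: mps_coeff_const_mult) (simp add: mps_const_def)
qed

lemma mps_const_of_nat: "mps_const (of_nat k) = of_nat k"
  by (induction k) (simp_all add: mps_const_hom)

text \<open>The ring of series contains the complex numbers, hence positive integers are invertible in it.\<close>

lemma mps_of_nat_cancel:
  fixes f g :: "'v mps"
  assumes "of_nat (Suc k) * f = of_nat (Suc k) * g" shows "f = g"
proof -
  have inv: "mps_const (1 / of_nat (Suc k)) * (of_nat (Suc k) :: 'v mps) = 1"
    unfolding mps_const_of_nat[symmetric] mps_const_hom(4)[symmetric]
    by (simp add: mps_const_hom del: of_nat_Suc)
  have "mps_const (1 / of_nat (Suc k)) * (of_nat (Suc k) * f) =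
      mps_const (1 / of_nat (Suc k)) * (of_nat (Suc k) * g)" using assms by simp
  then show ?thesis unfolding mult.assoc[symmetric] inv by simp
qed

lemma poly_mapping_eq_sum_single:
  fixes f :: "'k \<Rightarrow>\<^sub>0 'a::comm_monoid_add"
  shows "f = (\<Sum>m\<in>Poly_Mapping.keys f. Poly_Mapping.single m (Poly_Mapping.lookup f m))"
  by (rule poly_mapping_eqI)
     (simp add: lookup_sum lookup_single when_def in_keys_iff)

text \<open>Summation over any larger finite set of monomials, so that several elements can be evaluated over a common one.\<close>

lemma super_eval_superset:
  assumes "finite S" "Poly_Mapping.keys f \<subseteq> S"
  shows "super_eval x y f = (\<Sum>m\<in>S. mps_const (Poly_Mapping.lookup f m) *
        (\<Prod>k\<in>Poly_Mapping.keys m. super_psum x y (Suc k) ^ Poly_Mapping.lookup m k))"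
  unfolding super_eval_def using assms
  by (intro sum.mono_neutral_left) (auto simp: in_keys_iff mps_const_hom)

lemma super_eval_add: "super_eval x y (f + g) = super_eval x y f + super_eval x y g"
proof -
  let ?S = "Poly_Mapping.keys f \<union> Poly_Mapping.keys g"
  have "super_eval x y h = (\<Sum>m\<in>?S. mps_const (Poly_Mapping.lookup h m) *
        (\<Prod>k\<in>Poly_Mapping.keys m. super_psum x y (Suc k) ^ Poly_Mapping.lookup m k))"
    if "Poly_Mapping.keys h \<subseteq> ?S" for h
    using that by (intro super_eval_superset) auto
  from this[of f] this[of g] this[of "f + g"] show ?thesis
    using Poly_Mapping.keys_add[of f g] by (simp add: lookup_add mps_const_hom distrib_right sum.distrib)
qed

lemma super_eval_zero: "super_eval x y 0 = 0"
  by (simp add: super_eval_def)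

lemma super_eval_sum: "super_eval x y (sum F I) = (\<Sum>i\<in>I. super_eval x y (F i))"
  by (induction I rule: infinite_finite_induct) (simp_all add: super_eval_zero super_eval_add)

lemma super_eval_single:
  "super_eval x y (Poly_Mapping.single m c) = mps_const c *
     (\<Prod>k\<in>Poly_Mapping.keys m. super_psum x y (Suc k) ^ Poly_Mapping.lookup m k)"
  by (simp add: super_eval_def mps_const_hom)

lemma prod_power_lookup_add:
  fixes P :: "'k \<Rightarrow> 'a::comm_monoid_mult" and m m' :: "'k \<Rightarrow>\<^sub>0 nat"
  shows "(\<Prod>k\<in>Poly_Mapping.keys (m + m'). P k ^ Poly_Mapping.lookup (m + m') k) =
    (\<Prod>k\<in>Poly_Mapping.keys m. P k ^ Poly_Mapping.lookup m k) *
    (\<Prod>k\<in>Poly_Mapping.keys m'. P k ^ Poly_Mapping.lookup m' k)"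
proof -
  let ?S = "Poly_Mapping.keys m \<union> Poly_Mapping.keys m'"
  have ext: "(\<Prod>k\<in>Poly_Mapping.keys n. P k ^ Poly_Mapping.lookup n k) = (\<Prod>k\<in>?S. P k ^ Poly_Mapping.lookup n k)"
    if "Poly_Mapping.keys n \<subseteq> ?S" for n
    using that by (intro prod.mono_neutral_left) (auto simp: in_keys_iff)
  have "(\<Prod>k\<in>?S. P k ^ Poly_Mapping.lookup (m + m') k) =
      (\<Prod>k\<in>?S. P k ^ Poly_Mapping.lookup m k) * (\<Prod>k\<in>?S. P k ^ Poly_Mapping.lookup m' k)"
    by (simp add: lookup_add power_add prod.distrib)
  then show ?thesis
    using ext[of m] ext[of m'] ext[of "m + m'"] Poly_Mapping.keys_add[of m m'] by simp
qed

lemma super_eval_mult: "super_eval x y (f * g) = super_eval x y f * super_eval x y g"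
proof -
  let ?k = Poly_Mapping.keys and ?l = Poly_Mapping.lookup
  have "f * g = (\<Sum>m\<in>?k f. \<Sum>m'\<in>?k g. Poly_Mapping.single (m + m') (?l f m * ?l g m'))"
    by (subst (1) poly_mapping_eq_sum_single[of f], subst (1) poly_mapping_eq_sum_single[of g])
       (simp add: sum_product mult_single)
  then have "super_eval x y (f * g) = (\<Sum>m\<in>?k f. \<Sum>m'\<in>?k g.
      super_eval x y (Poly_Mapping.single (m + m') (?l f m * ?l g m')))"
    by (simp add: super_eval_sum)
  also have "\<dots> = super_eval x y f * super_eval x y g"
    unfolding super_eval_single prod_power_lookup_add
    by (simp add: super_eval_def sum_product mps_const_hom mult_ac)
  finally show ?thesis .
qed

lemma super_eval_const: "super_eval x y (sym_const c) = mps_const c"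
  by (simp add: sym_const_def super_eval_single)

lemma super_eval_one: "super_eval x y 1 = 1"
  using super_eval_const[of x y 1] by (simp add: sym_const_def mps_const_hom)

lemma super_eval_hom: "comm_ring_hom (super_eval x y)"
  by unfold_locales (simp_all add: super_eval_zero super_eval_one super_eval_add super_eval_mult)

lemma super_eval_psum: "super_eval x y (psum (Suc k)) = super_psum x y (Suc k)"
  by (simp add: psum_def super_eval_single mps_const_hom)

section \<open>Adjoining one pair of variables\<close>

lemma sym_const_of_nat: "sym_const (of_nat k) = of_nat k"
  by (induction k) (simp_all add: sym_const_def single_add)

text \<open>
  The logarithmic derivative of \<open>H\<close> is \<open>\<Sum>\<^sub>k \<^bold>p\<^bsub>k+1\<^esub> z\<^sup>k\<close> with \<open>z = u\<^bsup>-1\<^esup>\<close>. Unlike the exponential itself,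
  this differential equation can be mapped directly into a ring that is not a field.
\<close>

lemma H_series_deriv: "fps_deriv H_series = Abs_fps (\<lambda>k. psum (Suc k)) * H_series"
proof -
  let ?e = "Abs_fps (\<lambda>k. sym_const (1 / fact k))"
  let ?P = "Abs_fps (\<lambda>k. if k = 0 then 0 else sym_const (1 / of_nat k) * psum k)"
  have "fps_deriv ?e = ?e"
    unfolding fps_eq_iff
    by (auto simp: sym_const_of_nat[symmetric] sym_const_mult simp del: of_nat_Suc)
  moreover have "fps_deriv ?P = Abs_fps (\<lambda>k. psum (Suc k))"
    unfolding fps_eq_iff
    by (auto simp: sym_const_of_nat[symmetric] sym_const_mult mult.assoc[symmetric] simp del: of_nat_Suc)
       (simp add: sym_const_def)
  moreover have "fps_deriv H_series = (fps_deriv ?e oo ?P) * fps_deriv ?P"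
    unfolding H_series_def by (rule fps_compose_deriv) simp
  ultimately show ?thesis by (simp add: H_series_def mult.commute)
qed

definition super_H :: "(nat \<Rightarrow> 'v mps) \<Rightarrow> (nat \<Rightarrow> 'v mps) \<Rightarrow> 'v mps fps" where
  "super_H x y = Abs_fps (\<lambda>k. super_eval x y (fps_nth H_series k))"

lemma super_H_deriv: "fps_deriv (super_H x y) = Abs_fps (\<lambda>k. super_psum x y (Suc k)) * super_H x y"
proof (rule fps_ext)
  fix k
  interpret comm_ring_hom "super_eval x y" by (rule super_eval_hom)
  have "super_eval x y (fps_nth (fps_deriv H_series) k) =
      super_eval x y (fps_nth (Abs_fps (\<lambda>k. psum (Suc k)) * H_series) k)"
    by (simp only: H_series_deriv)
  then show "fps_nth (fps_deriv (super_H x y)) k =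
      fps_nth (Abs_fps (\<lambda>k. super_psum x y (Suc k)) * super_H x y) k"
    by (simp add: super_H_def fps_mult_nth hom_distribs super_eval_psum del: of_nat_Suc)
qed

lemma super_H_0: "fps_nth (super_H x y) 0 = 1"
  by (simp add: super_H_def H_series_0 super_eval_one)

lemma mps_linear_ode_unique:
  fixes F G :: "'v mps fps"
  assumes "fps_deriv F = Q * F" "fps_deriv G = Q * G" "fps_nth F 0 = fps_nth G 0"
  shows "F = G"
proof (rule fps_ext)
  fix n show "fps_nth F n = fps_nth G n"
  proof (induction n rule: less_induct)
    case (less n)
    show ?case
    proof (cases n)
      case 0 then show ?thesis using assms(3) by simp
    next
      case (Suc m)
      have "of_nat (Suc m) * fps_nth F (Suc m) = fps_nth (Q * F) m"
        using assms(1) by (metis fps_deriv_nth Suc_eq_plus1)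
      also have "\<dots> = fps_nth (Q * G) m"
        unfolding fps_mult_nth using less Suc by (intro sum.cong) auto
      also have "\<dots> = of_nat (Suc m) * fps_nth G (Suc m)"
        using assms(2) by (metis fps_deriv_nth Suc_eq_plus1)
      finally show ?thesis unfolding Suc by (rule mps_of_nat_cancel)
    qed
  qed
qed

text \<open>
  Adjoining the pair \<open>(u, v)\<close> multiplies \<open>H\<close> by \<open>(1 + v z) / (1 - u z)\<close>; the statement clears the
  denominator. Both sides satisfy the same first-order linear differential equation, because
  \<open>u / (1 - u z)\<close> and \<open>v / (1 + v z)\<close> are the generating series of the power sums of the new variables.
\<close>

lemma super_H_adjoin_pair:
  assumes psum: "\<And>k. super_psum x' y' (Suc k) = super_psum x y (Suc k) + u ^ Suc k + (- 1) ^ k * v ^ Suc k"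
  shows "(1 - fps_const u * fps_X) * super_H x' y' = (1 + fps_const v * fps_X) * super_H x y"
proof (rule mps_linear_ode_unique)
  define Q where "Q = Abs_fps (\<lambda>k. super_psum x y (Suc k))"
  define gu where "gu = Abs_fps (\<lambda>k. u ^ Suc k)"
  define gv where "gv = Abs_fps (\<lambda>k. (- 1) ^ k * v ^ Suc k)"
  have gu: "(1 - fps_const u * fps_X) * gu = fps_const u"
    unfolding fps_eq_iff gu_def
    by (auto simp: algebra_simps fps_X_mult_nth[unfolded mult.commute[of fps_X]] split: nat.split)
       (case_tac n; simp)
  have gv: "(1 + fps_const v * fps_X) * gv = fps_const v"
    unfolding fps_eq_iff gv_def
    by (auto simp: algebra_simps)
       (case_tac n; simp)
  have "Abs_fps (\<lambda>k. super_psum x' y' (Suc k)) = Q + gu + gv"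
    unfolding fps_eq_iff by (simp add: Q_def gu_def gv_def psum)
  then have d': "fps_deriv (super_H x' y') = (Q + gu + gv) * super_H x' y'"
    by (simp add: super_H_deriv)
  have d: "fps_deriv (super_H x y) = Q * super_H x y"
    by (simp add: super_H_deriv Q_def)
  have "fps_deriv ((1 - fps_const u * fps_X) * super_H x' y') =
      - (fps_const u * super_H x' y') + (1 - fps_const u * fps_X) * (Q + gu + gv) * super_H x' y'"
    by (simp add: d' algebra_simps fps_const_neg[symmetric] del: fps_const_neg)
  also have "\<dots> = (Q + gv) * ((1 - fps_const u * fps_X) * super_H x' y') +
      ((1 - fps_const u * fps_X) * gu - fps_const u) * super_H x' y'"
    by (simp add: algebra_simps)
  finally show "fps_deriv ((1 - fps_const u * fps_X) * super_H x' y') =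
      (Q + gv) * ((1 - fps_const u * fps_X) * super_H x' y')" by (simp add: gu)
  have "fps_deriv ((1 + fps_const v * fps_X) * super_H x y) =
      fps_const v * super_H x y + (1 + fps_const v * fps_X) * Q * super_H x y"
    by (simp add: d algebra_simps)
  also have "\<dots> = (Q + gv) * ((1 + fps_const v * fps_X) * super_H x y) +
      (fps_const v - (1 + fps_const v * fps_X) * gv) * super_H x y"
    by (simp add: algebra_simps)
  finally show "fps_deriv ((1 + fps_const v * fps_X) * super_H x y) =
      (Q + gv) * ((1 + fps_const v * fps_X) * super_H x y)" by (simp add: gv)
qed (simp add: super_H_0)

text \<open>
  The coefficient of \<open>z\<^sup>n\<close> in \<open>\<Prod>\<^bsub>1 \<le> i \<le> k\<^esub> z / (1 - b\<^sub>i z)\<close>, i.e. a complete homogeneous symmetric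
  polynomial of \<open>b\<^sub>1, \<dots>, b\<^sub>k\<close>. The recursion makes sense over any ring and commutes with homomorphisms.
\<close>

fun newton_coeff :: "(nat \<Rightarrow> 'a::comm_ring_1) \<Rightarrow> nat \<Rightarrow> nat \<Rightarrow> 'a" where
  "newton_coeff b 0 n = (if n = 0 then 1 else 0)"
| "newton_coeff b (Suc k) 0 = 0"
| "newton_coeff b (Suc k) (Suc n) = newton_coeff b k n + b (Suc k) * newton_coeff b (Suc k) n"

lemma newton_coeff_upper: "n < k \<Longrightarrow> newton_coeff b k n = 0"
  by (induction b k n rule: newton_coeff.induct) auto

lemma newton_coeff_diag: "newton_coeff b k k = 1"
  by (induction k) (simp_all add: newton_coeff_upper)

lemma newton_expansion_unique:
  fixes g g' :: "nat \<Rightarrow> 'a::comm_ring_1"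
  assumes "\<And>n. (\<Sum>k\<le>n. g k * newton_coeff b k n) = (\<Sum>k\<le>n. g' k * newton_coeff b k n)"
  shows "g n = g' n"
proof (induction n rule: less_induct)
  case (less n)
  have "(\<Sum>k<n. g k * newton_coeff b k n) = (\<Sum>k<n. g' k * newton_coeff b k n)"
    using less by (intro sum.cong) auto
  then show ?case using assms[of n] by (simp add: lessThan_Suc_atMost[symmetric] newton_coeff_diag)
qed

text \<open>
  For the series variable \<open>z = 1 / t\<close>, multiplication by \<open>t - u\<close> acts on a Newton expansion by
  \<open>(t - u) / ((t - b\<^sub>1) \<dots> (t - b\<^sub>k)) = 1 / ((t - b\<^sub>1) \<dots> (t - b\<^bsub>k-1\<^esub>)) + (b\<^sub>k - u) / ((t - b\<^sub>1) \<dots> (t - b\<^sub>k))\<close>.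
  For \<open>k = 0\<close> the same pattern reads \<open>t - u = (t - b\<^sub>0) + (b\<^sub>0 - u)\<close> with \<open>b\<^sub>0\<close> arbitrary; the summand
  \<open>t - b\<^sub>0\<close> is responsible for the correction at \<open>n = 0\<close>.
\<close>

lemma newton_expansion_times_linear:
  fixes g F :: "nat \<Rightarrow> 'a::comm_ring_1"
  assumes F: "\<And>n. F n = (\<Sum>k\<le>n. g k * newton_coeff b k n)"
  shows "F (Suc n) - u * F n =
    (\<Sum>k\<le>n. (g (Suc k) + (b k - u) * g k) * newton_coeff b k n) - (if n = 0 then b 0 * g 0 else 0)"
proof -
  have "F (Suc n) = (\<Sum>k\<le>n. g (Suc k) * newton_coeff b (Suc k) (Suc n))"
    unfolding F by (subst sum.atMost_Suc_shift) simp
  also have "\<dots> = (\<Sum>k\<le>n. g (Suc k) * newton_coeff b k n) +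
      (\<Sum>k\<le>n. g (Suc k) * b (Suc k) * newton_coeff b (Suc k) n)"
    by (simp add: algebra_simps sum.distrib)
  also have "(\<Sum>k\<le>n. g (Suc k) * b (Suc k) * newton_coeff b (Suc k) n) =
      (\<Sum>k\<le>Suc n. g k * b k * newton_coeff b k n) - g 0 * b 0 * newton_coeff b 0 n"
    by (subst sum.atMost_Suc_shift) simp
  also have "(\<Sum>k\<le>Suc n. g k * b k * newton_coeff b k n) = (\<Sum>k\<le>n. g k * b k * newton_coeff b k n)"
    by (simp add: newton_coeff_upper)
  finally show ?thesis
    by (auto simp: F sum_distrib_left sum.distrib sum_subtractf algebra_simps)
qed

lemma inv_falling_eq_newton_coeff:
  "fps_nth (inv_falling a k) n = newton_coeff (\<lambda>i. sym_const (a (int i))) k n"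
proof (induction "\<lambda>i. sym_const (a (int i))" k n rule: newton_coeff.induct)
  case (1 n)
  then show ?case by (simp add: inv_falling_def)
next
  case (2 k)
  then show ?case by (simp add: inv_falling_def inv_linear_def fps_prod_nth)
next
  case (3 k n)
  let ?c = "sym_const (a (int (Suc k)))"
  have "(1 - fps_const ?c * fps_X) * inv_falling a (Suc k) = fps_X * inv_falling a k"
    using inv_linear_correct[of "a (int (Suc k))"]
    by (simp add: inv_falling_def mult_ac)
  then have "inv_falling a (Suc k) = fps_X * inv_falling a k + fps_const ?c * (fps_X * inv_falling a (Suc k))"
    by (simp only: left_diff_distrib mult.assoc mult_1_left diff_eq_eq)
  then have "fps_nth (inv_falling a (Suc k)) (Suc n) =
      fps_nth (fps_X * inv_falling a k + fps_const ?c * (fps_X * inv_falling a (Suc k))) (Suc n)"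
    by (rule arg_cong)
  then have "fps_nth (inv_falling a (Suc k)) (Suc n) =
      fps_nth (inv_falling a k) n + ?c * fps_nth (inv_falling a (Suc k)) n"
    by (simp del: of_nat_Suc)
  with 3 show ?case by simp
qed

lemma super_H_newton_expansion:
  "fps_nth (super_H x y) n =
    (\<Sum>k\<le>n. super_eval x y (hA_nat a k) * newton_coeff (\<lambda>i. mps_const (a (int i))) k n)"
proof -
  interpret comm_ring_hom "super_eval x y" by (rule super_eval_hom)
  have hom_newton: "super_eval x y (newton_coeff b k n) = newton_coeff (\<lambda>i. super_eval x y (b i)) k n" for b k n
    by (induction b k n rule: newton_coeff.induct) (simp_all add: hom_distribs)
  have "fps_nth H_series n = hA_nat a n + (\<Sum>k<n. hA_nat a k * fps_nth (inv_falling a k) n)"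
    using hA_nat_sums inv_falling_sums_iff by blast
  also have "\<dots> = (\<Sum>k\<le>n. hA_nat a k * newton_coeff (\<lambda>i. sym_const (a (int i))) k n)"
    by (simp add: lessThan_Suc_atMost[symmetric] newton_coeff_diag inv_falling_eq_newton_coeff)
  finally show ?thesis
    by (simp add: super_H_def hom_distribs hom_newton super_eval_const)
qed

text \<open>
  Comparison of Newton coefficients in \<open>(1 - u z) H' = (1 + v z) H\<close>. The identity holds for all integers
  \<open>m\<close>; at \<open>m = -1\<close> it is \<open>h\<^sub>0 = 1\<close> on both sides.
\<close>

lemma hA_adjoin_pair:
  assumes psum: "\<And>k. super_psum x' y' (Suc k) = super_psum x y (Suc k) + u ^ Suc k + (- 1) ^ k * v ^ Suc k"
  shows "super_eval x' y' (hA a (m + 1)) - (u - mps_const (a m)) * super_eval x' y' (hA a m) =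
    super_eval x y (hA a (m + 1)) + (v + mps_const (a m)) * super_eval x y (hA a m)"
proof -
  define b :: "nat \<Rightarrow> 'a mps" where "b i = mps_const (a (int i))" for i
  define g where "g k = super_eval x y (hA_nat a k)" for k
  define g' where "g' k = super_eval x' y' (hA_nat a k)" for k
  have g0: "g 0 = 1" "g' 0 = 1" by (simp_all add: g_def g'_def hA_nat_0 super_eval_one)
  have F: "fps_nth (super_H x y) n = (\<Sum>k\<le>n. g k * newton_coeff b k n)"
    and F': "fps_nth (super_H x' y') n = (\<Sum>k\<le>n. g' k * newton_coeff b k n)" for n
    unfolding g_def g'_def b_def by (rule super_H_newton_expansion)+
  have "g' (Suc k) + (b k - u) * g' k = g (Suc k) + (b k - (- v)) * g k" for k
  proof (rule newton_expansion_unique)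
    fix n
    have "fps_nth ((1 - fps_const u * fps_X) * super_H x' y') (Suc n) =
        fps_nth ((1 + fps_const v * fps_X) * super_H x y) (Suc n)"
      by (simp only: super_H_adjoin_pair[OF psum])
    then have "fps_nth (super_H x' y') (Suc n) - u * fps_nth (super_H x' y') n =
        fps_nth (super_H x y) (Suc n) - (- v) * fps_nth (super_H x y) n"
      by (simp add: left_diff_distrib distrib_right mult.assoc)
    then show "(\<Sum>k\<le>n. (g' (Suc k) + (b k - u) * g' k) * newton_coeff b k n) =
        (\<Sum>k\<le>n. (g (Suc k) + (b k - (- v)) * g k) * newton_coeff b k n)"
      unfolding newton_expansion_times_linear[of "fps_nth (super_H x y)", OF F]
        newton_expansion_times_linear[of "fps_nth (super_H x' y')", OF F'] g0 by simp
  qed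
  note rec = this
  consider "m < - 1" | "m = - 1" | k where "m = int k"
    by (metis linorder_neqE_linordered_idom nonneg_int_cases not_less zle_add1_eq_le add.commute add.left_inverse)
  then show ?thesis
  proof cases
    case 1 then show ?thesis by (simp add: hA_def super_eval_zero)
  next
    case 2 then show ?thesis by (simp add: hA_def super_eval_zero hA_nat_0 super_eval_one)
  next
    case 3
    have "nat (1 + int k) = Suc k" by simp
    with 3 rec[of k] show ?thesis
      by (simp add: hA_def g_def g'_def b_def algebra_simps)
  qed
qed

section \<open>Branching of multiparameter Schur functions\<close>

text \<open>
  The coefficient of \<open>1 / \<phi>\<^sub>l\<close> in \<open>H / \<phi>\<^bsub>-j\<^esub>\<close>. In this indexing the recurrence in \<open>l\<close> has weights
  depending on \<open>l\<close> alone and not on the column.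
\<close>

definition newton_matrix :: "(int \<Rightarrow> complex) \<Rightarrow> (nat \<Rightarrow> 'v mps) \<Rightarrow> (nat \<Rightarrow> 'v mps) \<Rightarrow> int \<Rightarrow> nat \<Rightarrow> 'v mps" where
  "newton_matrix a x y l j = super_eval x y (hA (shift (- int j) a) (l + int j))"

lemma super_eval_multi_schur:
  "super_eval x y (multi_schur N \<mu> a) = beta_det N (newton_matrix a x y) (part \<mu>)"
proof -
  interpret comm_ring_hom "super_eval x y" by (rule super_eval_hom)
  show ?thesis
    unfolding multi_schur_def beta_det_def hom_det[symmetric]
    by (intro arg_cong[where f = det] eq_matI) (auto simp: newton_matrix_def Let_def algebra_simps)
qed

lemma newton_matrix_zero: "l < - int j \<Longrightarrow> newton_matrix a x y l j = 0"
  by (simp add: newton_matrix_def hA_def super_eval_zero)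

text \<open>
  The identity of \<open>hA_adjoin_pair\<close> equates a combination of rows for \<open>x', y'\<close> with one for \<open>x, y\<close>; their common
  value is the intermediate matrix between the vertical and the horizontal step.
\<close>

lemma schur_branching:
  fixes x y x' y' :: "nat \<Rightarrow> 'v mps"
  assumes psum: "\<And>k. super_psum x' y' (Suc k) = super_psum x y (Suc k) + u ^ Suc k + (- 1) ^ k * v ^ Suc k"
    and p: "p \<in> shapes N"
  shows "beta_det N (newton_matrix a x' y') p =
    (\<Sum>q\<in>horizontal_below p. (\<Prod>s\<in>squares p - squares q. u - mps_const (a (content s))) *
      (\<Sum>r\<in>vertical_below q. (\<Prod>s\<in>squares q - squares r. v + mps_const (a (content s))) *
        beta_det N (newton_matrix a x y) r))"
proof -
  \<comment> \<open>with series variable \<open>1 / t\<close>, the matrix of \<open>H (t + v) / (t - a\<^sub>0)\<close> for the sequence \<open>a\<close> shifted by \<open>-1\<close>\<close>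
  define Y where "Y l j = newton_matrix a x y l j + (v + mps_const (a (l - 1))) * newton_matrix a x y (l - 1) j" for l j
  have rec: "newton_matrix a x' y' l j = Y l j + (u - mps_const (a (l - 1))) * newton_matrix a x' y' (l - 1) j" for l j
    using hA_adjoin_pair[OF psum, of "shift (- int j) a" "l - 1 + int j"]
    by (simp add: newton_matrix_def Y_def shift_def algebra_simps)
  have "beta_det N (newton_matrix a x' y') p =
      (\<Sum>q\<in>horizontal_below p. (\<Prod>s\<in>squares p - squares q. u - mps_const (a (content s))) * beta_det N Y q)"
    by (rule beta_det_horizontal[OF p newton_matrix_zero, where v = "\<lambda>c. u - mps_const (a c)"]) (auto intro: rec)
  moreover have "beta_det N Y q = (\<Sum>r\<in>vertical_below q.
      (\<Prod>s\<in>squares q - squares r. v + mps_const (a (content s))) * beta_det N (newton_matrix a x y) r)"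
    if "q \<in> horizontal_below p" for q
    by (rule beta_det_vertical[OF horizontal_below_shapes[OF p that] newton_matrix_zero, where v = "\<lambda>c. v + mps_const (a c)"])
       (auto simp: Y_def)
  ultimately show ?thesis by simp
qed

lemma schur_no_variables:
  fixes x y :: "nat \<Rightarrow> 'v mps"
  assumes psum: "\<And>k. super_psum x y (Suc k) = 0" and p: "p \<in> shapes N"
  shows "beta_det N (newton_matrix a x y) p = (if p = (\<lambda>_. 0) then 1 else 0)"
proof -
  have H: "super_H x y = 1"
    by (rule mps_linear_ode_unique[of _ 0]) (auto simp: super_H_deriv psum super_H_0 fps_eq_iff fps_mult_nth)
  have h: "super_eval x y (hA b m) = (if m = 0 then 1 else 0)" for b m
  proof (cases "m < 0")
    case False
    define c :: "nat \<Rightarrow> 'v mps" where "c i = mps_const (b (int i))" for i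
    have "super_eval x y (hA_nat b k) = (if k = 0 then 1 else 0)" for k
    proof (rule newton_expansion_unique[of "\<lambda>k. super_eval x y (hA_nat b k)" c "\<lambda>k. if k = 0 then 1 else 0"])
      fix n
      have "(\<Sum>k\<le>n. super_eval x y (hA_nat b k) * newton_coeff c k n) = (if n = 0 then 1 else 0)"
        unfolding c_def super_H_newton_expansion[symmetric] H by simp
      also have "\<dots> = (\<Sum>k\<le>n. (if k = 0 then newton_coeff c 0 n else 0))"
        by (subst sum.delta) auto
      also have "\<dots> = (\<Sum>k\<le>n. (if k = 0 then 1 else 0) * newton_coeff c k n)"
        by (intro sum.cong) auto
      finally show "(\<Sum>k\<le>n. super_eval x y (hA_nat b k) * newton_coeff c k n) =
          (\<Sum>k\<le>n. (if k = 0 then 1 else 0) * newton_coeff c k n)" .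
    qed
    with False show ?thesis by (simp add: hA_def)
  qed (simp add: hA_def super_eval_zero)
  show ?thesis
  proof (cases "p = (\<lambda>_. 0)")
    case True
    have "mat N N (\<lambda>(i, j). newton_matrix a x y (int (p (Suc i)) - int i) j) = 1\<^sub>m N"
      by (rule eq_matI) (auto simp: True newton_matrix_def h)
    with True show ?thesis by (simp add: beta_det_def)
  next
    case False
    have "p 1 \<noteq> 0"
    proof
      assume "p 1 = 0"
      have "p i = 0" for i
      proof (induction i)
        case (Suc i)
        show ?case
        proof (cases i)
          case 0 with \<open>p 1 = 0\<close> show ?thesis by simp
        next
          case (Suc k)
          with p have "p (Suc i) \<le> p i" by (simp add: shapes_def)
          with Suc.IH show ?thesis by simp
        qed
      qed (use p in \<open>simp add: shapes_def\<close>)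
      with False show False by auto
    qed
    moreover from this have "0 < N" using p by (auto simp: shapes_def intro: ccontr)
    ultimately show ?thesis using False
      by (auto simp: beta_det_def newton_matrix_def h intro!: det_zero_row[of 0])
  qed
qed

section \<open>Letter tableaux and their outermost strips\<close>

fun is_primed :: "letter \<Rightarrow> bool" where
  "is_primed (Primed k) = True"
| "is_primed (Unprimed k) = False"

text \<open>
  The common generalisation of letter tableaux to an arbitrary alphabet, in which letters can be added one by
  one. The conditions on repeated letters are stated for pairs of squares instead of by cardinalities.
\<close>

definition tableaux_over :: "letter set \<Rightarrow> (nat \<Rightarrow> nat) \<Rightarrow> (nat \<times> nat \<Rightarrow> letter) set" where
  "tableaux_over A p = {T \<in> squares p \<rightarrow>\<^sub>E A. weakly_increasing (squares p) T \<and>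
     (\<forall>s\<in>squares p. \<forall>t\<in>squares p. T s = T t \<and> s \<noteq> t \<longrightarrow>
        (if is_primed (T s) then fst s \<noteq> fst t else snd s \<noteq> snd t))}"

definition strips_below :: "letter \<Rightarrow> (nat \<Rightarrow> nat) \<Rightarrow> (nat \<Rightarrow> nat) set" where
  "strips_below L p = (if is_primed L then vertical_below p else horizontal_below p)"

definition row_lengths :: "(nat \<times> nat) set \<Rightarrow> nat \<Rightarrow> nat" where
  "row_lengths D i = card {j. (i, j) \<in> D}"

lemma row_lengths_squares:
  assumes "q 0 = 0" shows "row_lengths (squares q) = q"
proof
  fix i
  have "{j. (i, j) \<in> squares q} = {1..q i}"
    using assms by (cases i) (auto simp: squares_def)
  then show "row_lengths (squares q) i = q i" by (simp add: row_lengths_def)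
qed

lemma squares_row_lengths:
  assumes sub: "D \<subseteq> squares p"
    and left: "\<And>i j j'. (i, j) \<in> D \<Longrightarrow> 1 \<le> j' \<Longrightarrow> j' \<le> j \<Longrightarrow> (i, j') \<in> D"
  shows "squares (row_lengths D) = D"
proof -
  have row: "{j. (i, j) \<in> D} = {1..row_lengths D i}" for i
  proof (cases "{j. (i, j) \<in> D} = {}")
    case True then show ?thesis by (simp add: row_lengths_def)
  next
    case False
    have fin: "finite {j. (i, j) \<in> D}"
      by (rule finite_subset[of _ "{..p i}"]) (use sub in \<open>auto simp: squares_def\<close>)
    let ?m = "Max {j. (i, j) \<in> D}"
    have "(i, ?m) \<in> D" using Max_in[OF fin False] by simp
    then have "{1..?m} \<subseteq> {j. (i, j) \<in> D}" using left by auto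
    moreover have "{j. (i, j) \<in> D} \<subseteq> {1..?m}"
      using Max_ge[OF fin] sub by (auto simp: squares_def)
    ultimately have eq: "{j. (i, j) \<in> D} = {1..?m}" by simp
    have "row_lengths D i = ?m" unfolding row_lengths_def using arg_cong[OF eq, of card] by simp
    with eq show ?thesis by simp
  qed
  have "(i, j) \<in> squares (row_lengths D) \<longleftrightarrow> (i, j) \<in> D" for i j
  proof -
    have "(i, j) \<in> D \<longleftrightarrow> 1 \<le> j \<and> j \<le> row_lengths D i" using row[of i] by auto
    moreover have "1 \<le> i" if "(i, j) \<in> D" using that sub by (auto simp: squares_def)
    ultimately show ?thesis by (auto simp: squares_def)
  qed
  then show ?thesis by auto
qed

lemma shape_antimono:
  assumes "p \<in> shapes N" "1 \<le> i" "i \<le> k" shows "p k \<le> p i"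
  using assms(3)
proof (induction k rule: dec_induct)
  case (step k)
  then have "p (Suc k) \<le> p k" using assms by (simp add: shapes_def)
  with step.IH show ?case by simp
qed simp

lemma strips_below_shapes: "p \<in> shapes N \<Longrightarrow> q \<in> strips_below L p \<Longrightarrow> q \<in> shapes N"
  using vertical_below_shapes[of p N q] horizontal_below_shapes[of p N q]
  by (cases "is_primed L") (simp_all add: strips_below_def)

lemma strips_below_le:
  assumes "q \<in> strips_below L p" shows "q i \<le> p i"
  using assms by (cases i) (auto simp: strips_below_def vertical_below_def horizontal_below_def split: if_splits)

lemma finite_strips_below:
  assumes p: "p \<in> shapes N" shows "finite (strips_below L p)"
proof (rule finite_subset)
  show "strips_below L p \<subseteq> {f. \<forall>x. (x \<in> {..N} \<longrightarrow> f x \<in> (\<Union>i\<le>N. {..p i})) \<and> (x \<notin> {..N} \<longrightarrow> f x = 0)}"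
  proof (rule subsetI, rule CollectI, intro allI conjI impI)
    fix f x assume f: "f \<in> strips_below L p"
    show "x \<in> {..N} \<Longrightarrow> f x \<in> (\<Union>i\<le>N. {..p i})" using strips_below_le[OF f] by blast
    show "x \<notin> {..N} \<Longrightarrow> f x = 0" using strips_below_shapes[OF p f] by (simp add: shapes_def)
  qed
  show "finite {f. \<forall>x. (x \<in> {..N} \<longrightarrow> f x \<in> (\<Union>i\<le>N. {..p i})) \<and> (x \<notin> {..N} \<longrightarrow> f x = (0::nat))}"
    by (rule finite_set_of_finite_funs) auto
qed

lemma finite_tableaux_over:
  assumes "p \<in> shapes N" "finite A" shows "finite (tableaux_over A p)"
  by (rule finite_subset[of _ "squares p \<rightarrow>\<^sub>E A"])
     (use finite_squares[OF assms(1)] assms(2) in \<open>auto simp: tableaux_over_def intro!: finite_PiE\<close>)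

lemma tableaux_overD:
  assumes "T \<in> tableaux_over A p"
  shows "s \<in> squares p \<Longrightarrow> T s \<in> A"
    and "s \<notin> squares p \<Longrightarrow> T s = undefined"
    and "(i, j) \<in> squares p \<Longrightarrow> (i, j') \<in> squares p \<Longrightarrow> j \<le> j' \<Longrightarrow> T (i, j) \<le> T (i, j')"
    and "(i, j) \<in> squares p \<Longrightarrow> (i', j) \<in> squares p \<Longrightarrow> i \<le> i' \<Longrightarrow> T (i, j) \<le> T (i', j)"
    and "s \<in> squares p \<Longrightarrow> t \<in> squares p \<Longrightarrow> T s = T t \<Longrightarrow> s \<noteq> t \<Longrightarrow> is_primed (T s) \<Longrightarrow> fst s \<noteq> fst t"
    and "s \<in> squares p \<Longrightarrow> t \<in> squares p \<Longrightarrow> T s = T t \<Longrightarrow> s \<noteq> t \<Longrightarrow> \<not> is_primed (T s) \<Longrightarrow> snd s \<noteq> snd t"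
proof -
  have T: "T \<in> squares p \<rightarrow>\<^sub>E A" "weakly_increasing (squares p) T"
    "\<And>s t. s \<in> squares p \<Longrightarrow> t \<in> squares p \<Longrightarrow> T s = T t \<Longrightarrow> s \<noteq> t \<Longrightarrow>
        (if is_primed (T s) then fst s \<noteq> fst t else snd s \<noteq> snd t)"
    using assms unfolding tableaux_over_def by blast+
  from T(1) show "s \<in> squares p \<Longrightarrow> T s \<in> A" "s \<notin> squares p \<Longrightarrow> T s = undefined"
    by (auto dest: PiE_mem PiE_arb)
  from T(2) show "(i, j) \<in> squares p \<Longrightarrow> (i, j') \<in> squares p \<Longrightarrow> j \<le> j' \<Longrightarrow> T (i, j) \<le> T (i, j')"
    "(i, j) \<in> squares p \<Longrightarrow> (i', j) \<in> squares p \<Longrightarrow> i \<le> i' \<Longrightarrow> T (i, j) \<le> T (i', j)"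
    unfolding weakly_increasing_def by blast+
  from T(3)[of s t] show
    "s \<in> squares p \<Longrightarrow> t \<in> squares p \<Longrightarrow> T s = T t \<Longrightarrow> s \<noteq> t \<Longrightarrow> is_primed (T s) \<Longrightarrow> fst s \<noteq> fst t"
    "s \<in> squares p \<Longrightarrow> t \<in> squares p \<Longrightarrow> T s = T t \<Longrightarrow> s \<noteq> t \<Longrightarrow> \<not> is_primed (T s) \<Longrightarrow> snd s \<noteq> snd t"
    by simp_all
qed

context
  fixes N :: nat and A :: "letter set" and L :: letter and p :: "nat \<Rightarrow> nat"
  assumes p: "p \<in> shapes N" and below_L: "\<And>K. K \<in> A \<Longrightarrow> K < L"
begin

definition inner_shape :: "(nat \<times> nat \<Rightarrow> letter) \<Rightarrow> nat \<Rightarrow> nat" where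
  "inner_shape T = row_lengths {s \<in> squares p. T s \<noteq> L}"

definition fill_strip :: "(nat \<Rightarrow> nat) \<Rightarrow> (nat \<times> nat \<Rightarrow> letter) \<Rightarrow> nat \<times> nat \<Rightarrow> letter" where
  "fill_strip q T s = (if s \<in> squares q then T s else if s \<in> squares p then L else undefined)"

lemma squares_inner_shape:
  assumes T: "T \<in> tableaux_over (insert L A) p"
  shows "squares (inner_shape T) = {s \<in> squares p. T s \<noteq> L}"
  unfolding inner_shape_def
proof (rule squares_row_lengths)
  fix i j j' assume *: "(i, j) \<in> {s \<in> squares p. T s \<noteq> L}" "1 \<le> j'" "j' \<le> j"
  then have "(i, j') \<in> squares p" by (auto simp: squares_def)
  moreover from this * have "T (i, j') \<le> T (i, j)" by (intro tableaux_overD(3)[OF T]) auto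
  moreover have "T (i, j) < L" using * tableaux_overD(1)[OF T, of "(i, j)"] below_L by auto
  ultimately show "(i, j') \<in> {s \<in> squares p. T s \<noteq> L}" by auto
qed auto

lemma inner_shape_strip:
  assumes T: "T \<in> tableaux_over (insert L A) p"
  shows "inner_shape T \<in> strips_below L p"
proof -
  note sq = squares_inner_shape[OF T]
  define q where "q = inner_shape T"
  have q0: "q 0 = 0" by (simp add: q_def inner_shape_def row_lengths_def squares_def)
  have mem: "T (i, j) = L \<longleftrightarrow> q i < j" if s: "(i, j) \<in> squares p" for i j
  proof -
    have "(i, j) \<in> squares q \<longleftrightarrow> T (i, j) \<noteq> L" using sq s by (simp add: q_def)
    moreover have "(i, j) \<in> squares q \<longleftrightarrow> j \<le> q i" using s by (simp add: squares_def)
    ultimately show ?thesis by auto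
  qed
  have le: "q i \<le> p i" for i
  proof (cases "1 \<le> i \<and> 1 \<le> q i")
    case True
    then have "(i, q i) \<in> squares q" by (simp add: squares_def)
    with sq have "(i, q i) \<in> squares p" by (auto simp: q_def)
    then show ?thesis by (simp add: squares_def)
  next
    case False with q0 show ?thesis by (cases i) auto
  qed
  have leL: "T s \<le> L" if "s \<in> squares p" for s
    using tableaux_overD(1)[OF T that] below_L[of "T s"] by auto
  have above: "T (Suc i, j) = L" if "T (i, j) = L" "(i, j) \<in> squares p" "(Suc i, j) \<in> squares p" for i j
    using tableaux_overD(4)[OF T that(2,3)] leL[OF that(3)] that(1) by simp
  show ?thesis
  proof (cases "is_primed L")
    case True
    have "p i \<le> Suc (q i)" for i
    proof (rule ccontr)
      assume "\<not> p i \<le> Suc (q i)"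
      then have gap: "q i + 2 \<le> p i" by simp
      with p have "i \<noteq> 0" by (cases i) (auto simp: shapes_def)
      with gap have s: "(i, p i) \<in> squares p" "(i, p i - 1) \<in> squares p" by (auto simp: squares_def)
      with gap have "T (i, p i) = L" "T (i, p i - 1) = L" by (simp_all add: mem)
      moreover have "(i, p i) \<noteq> (i, p i - 1)" using gap by simp
      ultimately show False using tableaux_overD(5)[OF T s] True by simp
    qed
    moreover have "q (Suc i) \<le> q i" if "1 \<le> i" for i
    proof (rule ccontr)
      assume less: "\<not> q (Suc i) \<le> q i"
      have "q (Suc i) \<le> p (Suc i)" "p (Suc i) \<le> p i" using le p that by (simp_all add: shapes_def)
      with less that have s: "(i, q (Suc i)) \<in> squares p" "(Suc i, q (Suc i)) \<in> squares p"
        by (auto simp: squares_def)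
      from less s(1) have "T (i, q (Suc i)) = L" by (simp add: mem)
      from above[OF this s] s(2) show False by (simp add: mem)
    qed
    ultimately show ?thesis using True le by (simp add: strips_below_def vertical_below_def q_def)
  next
    case False
    have "p (Suc i) \<le> q i" if "1 \<le> i" for i
    proof (rule ccontr)
      assume less: "\<not> p (Suc i) \<le> q i"
      have "p (Suc i) \<le> p i" using p that by (simp add: shapes_def)
      with less that have s: "(i, p (Suc i)) \<in> squares p" "(Suc i, p (Suc i)) \<in> squares p"
        by (auto simp: squares_def)
      from less s(1) have L: "T (i, p (Suc i)) = L" by (simp add: mem)
      from above[OF L s] L tableaux_overD(6)[OF T s] False show False by auto
    qed
    with False q0 le show ?thesis by (simp add: strips_below_def horizontal_below_def q_def)
  qed
qed

lemma strip_squares_subset: "q \<in> strips_below L p \<Longrightarrow> squares q \<subseteq> squares p"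
  using strips_below_le[of q L p] by (auto simp: squares_def intro: order_trans)

lemma restrict_inner_shape:
  assumes T: "T \<in> tableaux_over (insert L A) p"
  shows "restrict T (squares (inner_shape T)) \<in> tableaux_over A (inner_shape T)"
proof -
  note sq = squares_inner_shape[OF T]
  have "restrict T (squares (inner_shape T)) \<in> squares (inner_shape T) \<rightarrow>\<^sub>E A"
    using tableaux_overD(1)[OF T] by (auto simp: sq)
  moreover have "weakly_increasing (squares (inner_shape T)) (restrict T (squares (inner_shape T)))"
    using tableaux_overD(3,4)[OF T] unfolding weakly_increasing_def sq by auto
  moreover have "if is_primed (restrict T (squares (inner_shape T)) s) then fst s \<noteq> fst t else snd s \<noteq> snd t"
    if "s \<in> squares (inner_shape T)" "t \<in> squares (inner_shape T)"
      "restrict T (squares (inner_shape T)) s = restrict T (squares (inner_shape T)) t" "s \<noteq> t" for s t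
    using that tableaux_overD(5,6)[OF T, of s t] by (simp add: sq)
  ultimately show ?thesis unfolding tableaux_over_def by blast
qed

lemma fill_strip_tableau:
  assumes q: "q \<in> strips_below L p" and T: "T \<in> tableaux_over A q"
  shows "fill_strip q T \<in> tableaux_over (insert L A) p"
proof -
  note sub = strip_squares_subset[OF q]
  note qs = strips_below_shapes[OF p q]
  have ltL: "T s < L" if "s \<in> squares q" for s using tableaux_overD(1)[OF T that] below_L[of "T s"] by simp
  have funcset: "fill_strip q T \<in> squares p \<rightarrow>\<^sub>E insert L A"
    using tableaux_overD(1)[OF T] sub by (auto simp: fill_strip_def)
  have incr: "fill_strip q T s \<le> fill_strip q T t"
    if "t \<in> squares q \<Longrightarrow> s \<in> squares q \<and> T s \<le> T t" "s \<in> squares p" "t \<in> squares p" for s t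
    using that ltL[of s] by (auto simp: fill_strip_def)
  have "fill_strip q T (i, j) \<le> fill_strip q T (i, j')" if "(i, j) \<in> squares p" "(i, j') \<in> squares p" "j \<le> j'" for i j j'
    using that tableaux_overD(3)[OF T, of i j j'] by (intro incr) (auto simp: squares_def)
  moreover have "fill_strip q T (i, j) \<le> fill_strip q T (i', j)" if s: "(i, j) \<in> squares p" "(i', j) \<in> squares p" "i \<le> i'" for i i' j
  proof (intro incr s)
    assume *: "(i', j) \<in> squares q"
    with s shape_antimono[OF qs, of i i'] have "(i, j) \<in> squares q" by (auto simp: squares_def)
    with * s tableaux_overD(4)[OF T] show "(i, j) \<in> squares q \<and> T (i, j) \<le> T (i', j)" by blast
  qed
  ultimately have incr: "weakly_increasing (squares p) (fill_strip q T)"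
    unfolding weakly_increasing_def by blast
  have "if is_primed (fill_strip q T s) then fst s \<noteq> fst t else snd s \<noteq> snd t"
    if st: "s \<in> squares p" "t \<in> squares p" "fill_strip q T s = fill_strip q T t" "s \<noteq> t" for s t
  proof (cases "s \<in> squares q")
    case True
    then have "t \<in> squares q" using st ltL[of s] by (auto simp: fill_strip_def split: if_splits)
    with True st tableaux_overD(5,6)[OF T True this] show ?thesis by (simp add: fill_strip_def)
  next
    case False
    then have t: "t \<notin> squares q" using st ltL[of t] by (auto simp: fill_strip_def split: if_splits)
    have fL: "fill_strip q T s = L" using False st by (simp add: fill_strip_def)
    obtain i j i' j' where ij: "s = (i, j)" "t = (i', j')" by (cases s; cases t)
    from st(1,2) False t have gaps: "1 \<le> i" "1 \<le> i'" "1 \<le> j" "1 \<le> j'"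
      "q i < j" "j \<le> p i" "q i' < j'" "j' \<le> p i'" by (auto simp: ij squares_def)
    show ?thesis
    proof (cases "is_primed L")
      case True
      with q have "p i \<le> Suc (q i)" by (simp add: strips_below_def vertical_below_def)
      with gaps st(4) True fL show ?thesis by (auto simp: ij)
    next
      case False
      with q have h: "p (Suc k) \<le> q k" if "1 \<le> k" for k
        using that by (simp add: strips_below_def horizontal_below_def)
      have "j \<noteq> j'"
      proof
        assume "j = j'"
        with st(4) have "i \<noteq> i'" by (simp add: ij)
        then consider "i < i'" | "i' < i" using nat_neq_iff by blast
        then show False
        proof cases
          case 1
          then have "p i' \<le> p (Suc i)" by (intro shape_antimono[OF p]) auto
          with h[OF gaps(1)] gaps \<open>j = j'\<close> show False by simp
        next
          case 2
          then have "p i \<le> p (Suc i')" by (intro shape_antimono[OF p]) auto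
          with h[OF gaps(2)] gaps \<open>j = j'\<close> show False by simp
        qed
      qed
      with False fL show ?thesis by (simp add: ij)
    qed
  qed
  with funcset incr show ?thesis unfolding tableaux_over_def by blast
qed

lemma inner_shape_fill_strip:
  assumes q: "q \<in> strips_below L p" and T: "T \<in> tableaux_over A q"
  shows "inner_shape (fill_strip q T) = q" "restrict (fill_strip q T) (squares q) = T"
proof -
  note sub = strip_squares_subset[OF q]
  have "{s \<in> squares p. fill_strip q T s \<noteq> L} = squares q"
    using sub tableaux_overD(1)[OF T] below_L by (auto simp: fill_strip_def)
  then show "inner_shape (fill_strip q T) = q"
    using strips_below_shapes[OF p q] by (simp add: inner_shape_def row_lengths_squares shapes_def)
  show "restrict (fill_strip q T) (squares q) = T"
    using tableaux_overD(2)[OF T] by (auto simp: fun_eq_iff fill_strip_def)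
qed

lemma fill_strip_inner_shape:
  assumes T: "T \<in> tableaux_over (insert L A) p"
  shows "fill_strip (inner_shape T) (restrict T (squares (inner_shape T))) = T"
  using tableaux_overD(2)[OF T] by (auto simp: fun_eq_iff fill_strip_def squares_inner_shape[OF T])

text \<open>
  If \<open>L\<close> exceeds all letters of \<open>A\<close>, the squares not labelled \<open>L\<close> form a smaller shape: they are closed
  under moving left and up. The row or column condition for \<open>L\<close> says precisely that the difference
  is a vertical or horizontal strip, on which there is no further choice.
\<close>

lemma sum_tableaux_insert:
  fixes w :: "letter \<Rightarrow> nat \<times> nat \<Rightarrow> 'a::comm_ring_1"
  assumes fin: "finite A"
  shows "(\<Sum>T\<in>tableaux_over (insert L A) p. \<Prod>s\<in>squares p. w (T s) s) =
    (\<Sum>q\<in>strips_below L p. (\<Prod>s\<in>squares p - squares q. w L s) *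
       (\<Sum>T\<in>tableaux_over A q. \<Prod>s\<in>squares q. w (T s) s))"
proof -
  have "(\<Sum>T\<in>tableaux_over (insert L A) p. \<Prod>s\<in>squares p. w (T s) s) =
    (\<Sum>(q, T)\<in>Sigma (strips_below L p) (tableaux_over A).
      (\<Prod>s\<in>squares p - squares q. w L s) * (\<Prod>s\<in>squares q. w (T s) s))"
  proof (rule sum.reindex_bij_witness[where i = "\<lambda>(q, T). fill_strip q T"
        and j = "\<lambda>T. (inner_shape T, restrict T (squares (inner_shape T)))"])
    fix T assume T: "T \<in> tableaux_over (insert L A) p"
    show "(case (inner_shape T, restrict T (squares (inner_shape T))) of (q, T) \<Rightarrow> fill_strip q T) = T"
      using fill_strip_inner_shape[OF T] by simp
    show "(inner_shape T, restrict T (squares (inner_shape T))) \<in> Sigma (strips_below L p) (tableaux_over A)"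
      using inner_shape_strip[OF T] restrict_inner_shape[OF T] by simp
    note sq = squares_inner_shape[OF T]
    have "(\<Prod>s\<in>squares p. w (T s) s) =
        (\<Prod>s\<in>squares p - squares (inner_shape T). w (T s) s) * (\<Prod>s\<in>squares (inner_shape T). w (T s) s)"
      by (rule prod.subset_diff) (use finite_squares[OF p] in \<open>auto simp: sq\<close>)
    moreover have "(\<Prod>s\<in>squares p - squares (inner_shape T). w (T s) s) = (\<Prod>s\<in>squares p - squares (inner_shape T). w L s)"
      by (rule prod.cong) (auto simp: sq)
    ultimately show "(case (inner_shape T, restrict T (squares (inner_shape T))) of (q, T) \<Rightarrow>
        (\<Prod>s\<in>squares p - squares q. w L s) * (\<Prod>s\<in>squares q. w (T s) s)) = (\<Prod>s\<in>squares p. w (T s) s)"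
      by simp
  next
    fix b assume "b \<in> Sigma (strips_below L p) (tableaux_over A)"
    then obtain q T where b: "b = (q, T)" "q \<in> strips_below L p" "T \<in> tableaux_over A q" by auto
    then show "(\<lambda>T. (inner_shape T, restrict T (squares (inner_shape T)))) (case b of (q, T) \<Rightarrow> fill_strip q T) = b"
      "(case b of (q, T) \<Rightarrow> fill_strip q T) \<in> tableaux_over (insert L A) p"
      using inner_shape_fill_strip fill_strip_tableau by simp_all
  qed
  also have "\<dots> = (\<Sum>q\<in>strips_below L p. (\<Prod>s\<in>squares p - squares q. w L s) *
       (\<Sum>T\<in>tableaux_over A q. \<Prod>s\<in>squares q. w (T s) s))"
  proof (subst sum.Sigma[symmetric])
    show "\<forall>q\<in>strips_below L p. finite (tableaux_over A q)"
      using finite_tableaux_over[OF strips_below_shapes[OF p] fin] by blast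
  qed (simp_all add: finite_strips_below[OF p] sum_distrib_left)
  finally show ?thesis .
qed

end

lemma letters_upto_Suc:
  "letters_upto (Suc n) = insert (Unprimed (Suc n)) (insert (Primed (Suc n)) (letters_upto n))"
  by (auto simp: letters_upto_def atLeastAtMostSuc_conv)

lemma letters_upto_less:
  "K \<in> letters_upto n \<Longrightarrow> K < Primed (Suc n)"
  "K \<in> insert (Primed (Suc n)) (letters_upto n) \<Longrightarrow> K < Unprimed (Suc n)"
  by (auto simp: letters_upto_def less_letter_def)

lemma finite_letters_upto: "finite (letters_upto n)"
  by (simp add: letters_upto_def)

lemma sum_tableaux_empty_alphabet:
  fixes w :: "letter \<Rightarrow> nat \<times> nat \<Rightarrow> 'a::comm_ring_1"
  assumes p: "p \<in> shapes N"
  shows "(\<Sum>T\<in>tableaux_over {} p. \<Prod>s\<in>squares p. w (T s) s) = (if p = (\<lambda>_. 0) then 1 else 0)"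
proof (cases "p = (\<lambda>_. 0)")
  case True
  then have "squares p = {}" by (auto simp: squares_def)
  then show ?thesis using True by (simp add: tableaux_over_def weakly_increasing_def)
next
  case False
  then obtain i where "p i \<noteq> 0" by auto
  moreover from this p have "1 \<le> i" by (cases i) (auto simp: shapes_def)
  ultimately have "(i, 1) \<in> squares p" by (auto simp: squares_def)
  then have "tableaux_over {} p = {}" using tableaux_overD(1)[of _ "{}" p] by blast
  with False show ?thesis by simp
qed

lemma diagram_eq_squares: "diagram \<mu> = squares (part \<mu>)"
  by (simp add: diagram_def squares_def)

lemma part_shapes:
  assumes "is_partition \<mu>" "length \<mu> \<le> N" shows "part \<mu> \<in> shapes N"
proof -
  have "\<mu> ! (Suc k) \<le> \<mu> ! k" if "Suc k < length \<mu>" for k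
    using assms(1) that sorted_wrt_nth_less[of "(\<ge>)" \<mu> k "Suc k"] by (simp add: is_partition_def)
  then have "part \<mu> (Suc i) \<le> part \<mu> i" if "1 \<le> i" for i
    using that by (cases i) (auto simp: part_def)
  then show ?thesis using assms(2) by (auto simp: shapes_def part_def)
qed

lemma card_le_one_iff:
  "finite A \<Longrightarrow> card A \<le> 1 \<longleftrightarrow> (\<forall>s\<in>A. \<forall>t\<in>A. s = t)"
  using card_le_Suc0_iff_eq[of A] by simp

lemma letter_tableaux_eq_tableaux_over:
  assumes fin: "finite (diagram \<mu>)"
  shows "letter_tableaux \<mu> n = tableaux_over (letters_upto n) (part \<mu>)"
proof -
  have "(\<forall>k r. card {s \<in> diagram \<mu>. fst s = r \<and> T s = Primed k} \<le> 1) \<and>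
        (\<forall>k c. card {s \<in> diagram \<mu>. snd s = c \<and> T s = Unprimed k} \<le> 1) \<longleftrightarrow>
      (\<forall>s\<in>diagram \<mu>. \<forall>t\<in>diagram \<mu>. T s = T t \<and> s \<noteq> t \<longrightarrow>
        (if is_primed (T s) then fst s \<noteq> fst t else snd s \<noteq> snd t))" (is "?P \<and> ?U \<longleftrightarrow> ?R")
    for T :: "nat \<times> nat \<Rightarrow> letter"
  proof -
    have few: "card {s \<in> diagram \<mu>. Q s} \<le> 1 \<longleftrightarrow>
        (\<forall>s\<in>diagram \<mu>. \<forall>t\<in>diagram \<mu>. Q s \<and> Q t \<longrightarrow> s = t)" for Q
      using fin by (subst card_le_one_iff) auto
    have P: "?P \<longleftrightarrow> (\<forall>s\<in>diagram \<mu>. \<forall>t\<in>diagram \<mu>. \<forall>k. fst s = fst t \<and> T s = Primed k \<and> T t = Primed k \<longrightarrow> s = t)"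
      and U: "?U \<longleftrightarrow> (\<forall>s\<in>diagram \<mu>. \<forall>t\<in>diagram \<mu>. \<forall>k. snd s = snd t \<and> T s = Unprimed k \<and> T t = Unprimed k \<longrightarrow> s = t)"
      unfolding few by blast+
    show ?thesis
    proof (intro iffI ballI impI)
      fix s t assume st: "?P \<and> ?U" "s \<in> diagram \<mu>" "t \<in> diagram \<mu>" "T s = T t \<and> s \<noteq> t"
      show "if is_primed (T s) then fst s \<noteq> fst t else snd s \<noteq> snd t"
      proof (cases "T s")
        case (Primed k)
        moreover from this have "T t = Primed k" using st(4) by simp
        ultimately have "fst s \<noteq> fst t" using st unfolding P by blast
        with Primed show ?thesis by simp
      next
        case (Unprimed k)
        moreover from this have "T t = Unprimed k" using st(4) by simp
        ultimately have "snd s \<noteq> snd t" using st unfolding U by blast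
        with Unprimed show ?thesis by simp
      qed
    next
      assume R: ?R
      have "s = t" if "s \<in> diagram \<mu>" "t \<in> diagram \<mu>" "fst s = fst t" "T s = Primed k" "T t = Primed k" for s t k
        using R that by fastforce
      moreover have "s = t" if "s \<in> diagram \<mu>" "t \<in> diagram \<mu>" "snd s = snd t" "T s = Unprimed k" "T t = Unprimed k" for s t k
        using R that by fastforce
      ultimately show "?P \<and> ?U" unfolding P U by blast
    qed
  qed
  then show ?thesis
    unfolding letter_tableaux_def tableaux_over_def diagram_eq_squares[symmetric] by simp
qed

section \<open>Ribbons\<close>

fun has_left :: "(nat \<times> nat) set \<Rightarrow> nat \<times> nat \<Rightarrow> bool" where
  "has_left \<nu> (i, j) \<longleftrightarrow> 0 < j \<and> (i, j - 1) \<in> \<nu>"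

fun has_below :: "(nat \<times> nat) set \<Rightarrow> nat \<times> nat \<Rightarrow> bool" where
  "has_below \<nu> (i, j) \<longleftrightarrow> (Suc i, j) \<in> \<nu>"

text \<open>
  In a skew diagram this excludes \<open>2 \<times> 2\<close> blocks, since a left and a lower neighbour force the square
  diagonally between them. It is the form in which the absence of blocks is used.
\<close>

definition corner_free :: "(nat \<times> nat) set \<Rightarrow> bool" where
  "corner_free \<nu> \<longleftrightarrow> (\<forall>s\<in>\<nu>. \<not> (has_left \<nu> s \<and> has_below \<nu> s))"

definition square_factor ::
    "(int \<Rightarrow> complex) \<Rightarrow> (nat \<times> nat) set \<Rightarrow> 'v mps \<Rightarrow> 'v mps \<Rightarrow> nat \<times> nat \<Rightarrow> 'v mps" where
  "square_factor a \<nu> u v s =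
     (if has_left \<nu> s then u - mps_const (a (content s))
      else if has_below \<nu> s then v + mps_const (a (content s)) else u + v)"

text \<open>
  The next square towards the south-west end of a ribbon; the end itself is a fixed point. Contents
  drop by one in each proper step.
\<close>

fun predecessor :: "(nat \<times> nat) set \<Rightarrow> nat \<times> nat \<Rightarrow> nat \<times> nat" where
  "predecessor \<nu> (i, j) =
     (if has_left \<nu> (i, j) then (i, j - 1) else if has_below \<nu> (i, j) then (Suc i, j) else (i, j))"

lemma adjacency_predecessor:
  assumes "corner_free \<nu>" "(s, t) \<in> adjacency \<nu>"
  shows "predecessor \<nu> s = t \<or> predecessor \<nu> t = s"
  using assms by (cases s; cases t) (fastforce simp: adjacency_def corner_free_def)

lemma sym_adjacency: "sym (adjacency \<nu>)"
  by (auto simp: sym_def adjacency_def)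

text \<open>
  Adjacent squares are related by the predecessor map in one direction or the other, so following
  predecessors from any square of a component leads to the same fixed point.
\<close>

lemma component_reaches_root:
  assumes "corner_free \<nu>" "(s, r) \<in> (adjacency \<nu>)\<^sup>*" "predecessor \<nu> r = r"
  shows "\<exists>n. (predecessor \<nu> ^^ n) s = r"
  using assms(2)
proof (induction rule: converse_rtrancl_induct)
  case base
  show ?case by (rule exI[of _ 0]) simp
next
  case (step s t)
  then obtain n where n: "(predecessor \<nu> ^^ n) t = r" by blast
  from adjacency_predecessor[OF assms(1) step.hyps(1)] show ?case
  proof
    assume "predecessor \<nu> s = t"
    then have "(predecessor \<nu> ^^ Suc n) s = r" using n by (simp add: funpow_Suc_right del: funpow.simps)
    then show ?thesis by blast
  next
    assume ts: "predecessor \<nu> t = s"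
    show ?thesis
    proof (cases n)
      case 0
      with n ts assms(3) have "(predecessor \<nu> ^^ 0) s = r" by simp
      then show ?thesis by blast
    next
      case (Suc k)
      with n ts have "(predecessor \<nu> ^^ k) s = r" by (simp add: funpow_Suc_right del: funpow.simps)
      then show ?thesis by blast
    qed
  qed
qed

lemma component_subset: "s \<in> \<nu> \<Longrightarrow> (adjacency \<nu>)\<^sup>* `` {s} \<subseteq> \<nu>"
  by (auto elim: rtranclE simp: adjacency_def)

lemma component_closed:
  assumes "\<kappa> \<in> diagram_components \<nu>" "s \<in> \<kappa>" "(s, t) \<in> (adjacency \<nu>)\<^sup>*"
  shows "t \<in> \<kappa>"
  using assms by (auto simp: diagram_components_def)

lemma component_connected:
  assumes "\<kappa> \<in> diagram_components \<nu>" "s \<in> \<kappa>" "t \<in> \<kappa>"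
  shows "(s, t) \<in> (adjacency \<nu>)\<^sup>*"
proof -
  obtain r where "(r, s) \<in> (adjacency \<nu>)\<^sup>*" "(r, t) \<in> (adjacency \<nu>)\<^sup>*"
    using assms by (auto simp: diagram_components_def)
  then show ?thesis
    using symD[OF sym_rtrancl[OF sym_adjacency]] rtrancl_trans by metis
qed

lemma component_neighbours:
  assumes "\<kappa> \<in> diagram_components \<nu>" "s \<in> \<kappa>"
  shows "s \<in> \<nu>" "has_left \<kappa> s \<longleftrightarrow> has_left \<nu> s" "has_below \<kappa> s \<longleftrightarrow> has_below \<nu> s"
proof -
  have sub: "\<kappa> \<subseteq> \<nu>" using assms(1) component_subset by (auto simp: diagram_components_def)
  then show s: "s \<in> \<nu>" using assms(2) by blast
  have adj: "t \<in> \<kappa>" if "(s, t) \<in> adjacency \<nu>" for t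
    using component_closed[OF assms] that by blast
  obtain i j where ij: "s = (i, j)" by (cases s)
  have "(i, j - 1) \<in> \<kappa>" if "0 < j" "(i, j - 1) \<in> \<nu>"
    using that s by (intro adj) (auto simp: ij adjacency_def)
  then show "has_left \<kappa> s \<longleftrightarrow> has_left \<nu> s" using sub by (auto simp: ij)
  have "(Suc i, j) \<in> \<kappa>" if "(Suc i, j) \<in> \<nu>"
    using that s by (intro adj) (auto simp: ij adjacency_def)
  then show "has_below \<kappa> s \<longleftrightarrow> has_below \<nu> s" using sub by (auto simp: ij)
qed

text \<open>
  Existence: a square of least content has no predecessor. Uniqueness: iterating the predecessor map
  from one root would reach the other, but roots are fixed.
\<close>

lemma component_unique_root:
  assumes fin: "finite \<nu>" and cf: "corner_free \<nu>" and \<kappa>: "\<kappa> \<in> diagram_components \<nu>"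
  shows "\<exists>r. {s \<in> \<kappa>. \<not> has_left \<nu> s \<and> \<not> has_below \<nu> s} = {r}"
proof -
  have "\<kappa> \<subseteq> \<nu>" using component_neighbours(1)[OF \<kappa>] by blast
  with fin have fin\<kappa>: "finite \<kappa>" by (rule finite_subset[rotated])
  have "\<kappa> \<noteq> {}" using \<kappa> by (auto simp: diagram_components_def)
  with fin\<kappa> have "Min (content ` \<kappa>) \<in> content ` \<kappa>" by (intro Min_in) auto
  then obtain r where r: "r \<in> \<kappa>" "content r = Min (content ` \<kappa>)" by auto
  have min: "content r \<le> content t" if "t \<in> \<kappa>" for t
    using fin\<kappa> that unfolding r(2) by (intro Min_le) auto
  obtain i j where ij: "r = (i, j)" by (cases r)
  have "\<not> has_left \<kappa> r"
  proof
    assume "has_left \<kappa> r"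
    then have "0 < j" "(i, j - 1) \<in> \<kappa>" by (auto simp: ij)
    with min[of "(i, j - 1)"] show False by (simp add: ij of_nat_diff)
  qed
  moreover have "\<not> has_below \<kappa> r"
    using min[of "(Suc i, j)"] by (auto simp: ij)
  ultimately have root: "\<not> has_left \<nu> r" "\<not> has_below \<nu> r"
    using component_neighbours[OF \<kappa> r(1)] by auto
  have fixed: "predecessor \<nu> s = s" if "\<not> has_left \<nu> s" "\<not> has_below \<nu> s" for s
    using that by (cases s) (simp del: has_left.simps has_below.simps)
  have "s = r" if s: "s \<in> \<kappa>" "\<not> has_left \<nu> s" "\<not> has_below \<nu> s" for s
  proof -
    obtain n where "(predecessor \<nu> ^^ n) s = r"
      using component_reaches_root[OF cf component_connected[OF \<kappa> s(1) r(1)] fixed[OF root]] by blast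
    moreover have "(predecessor \<nu> ^^ n) s = s" by (induction n) (simp_all add: fixed[OF s(2,3)])
    ultimately show ?thesis by simp
  qed
  with r(1) root show ?thesis by blast
qed

text \<open>
  Each horizontally adjacent pair is attributed to its right square and each vertically adjacent pair to its
  upper square; the factor \<open>u + v\<close> goes to the root of the component.
\<close>

lemma f_connected_component:
  assumes fin: "finite \<nu>" and cf: "corner_free \<nu>" and \<kappa>: "\<kappa> \<in> diagram_components \<nu>"
  shows "f_connected a \<kappa> u v = (\<Prod>s\<in>\<kappa>. square_factor a \<nu> u v s)"
proof -
  note nb = component_neighbours[OF \<kappa>]
  have fin\<kappa>: "finite \<kappa>" using fin nb(1) by (meson finite_subset subsetI)
  obtain r where r: "{s \<in> \<kappa>. \<not> has_left \<nu> s \<and> \<not> has_below \<nu> s} = {r}"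
    using component_unique_root[OF assms] by blast
  define L where "L = {s \<in> \<kappa>. has_left \<nu> s}"
  define B where "B = {s \<in> \<kappa>. has_below \<nu> s}"
  have LB: "L \<inter> B = {}" using cf nb(1) by (auto simp: L_def B_def corner_free_def)
  have split: "\<kappa> = insert r (L \<union> B)" using r by (auto simp: L_def B_def)
  have rn: "r \<notin> L \<union> B" using r by (auto simp: L_def B_def)
  have finLB: "finite L" "finite B" using fin\<kappa> by (auto simp: L_def B_def)
  have "(\<Prod>s\<in>\<kappa>. square_factor a \<nu> u v s) = square_factor a \<nu> u v r *
      ((\<Prod>s\<in>L. square_factor a \<nu> u v s) * (\<Prod>s\<in>B. square_factor a \<nu> u v s))"
    using rn finLB LB by (subst split) (simp add: prod.union_disjoint)
  also have "square_factor a \<nu> u v r = u + v"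
    using r by (auto simp: square_factor_def)
  also have "(\<Prod>s\<in>L. square_factor a \<nu> u v s) =
      (\<Prod>(i, j)\<in>{(i, j). (i, j) \<in> \<kappa> \<and> (i, Suc j) \<in> \<kappa>}. u - mps_const (a (int j - int i + 1)))"
  proof (rule prod.reindex_bij_witness[where i = "\<lambda>(i, j). (i, Suc j)" and j = "\<lambda>(i, j). (i, j - 1)"])
    fix s assume "s \<in> L"
    then have s: "s \<in> \<kappa>" "has_left \<kappa> s" "has_left \<nu> s" using nb by (auto simp: L_def)
    obtain i j where ij: "s = (i, Suc j)" using s(2) by (cases s; cases "snd s") auto
    show "(case case s of (i, j) \<Rightarrow> (i, j - 1) of (i, j) \<Rightarrow> (i, Suc j)) = s"
      "(case s of (i, j) \<Rightarrow> (i, j - 1)) \<in> {(i, j). (i, j) \<in> \<kappa> \<and> (i, Suc j) \<in> \<kappa>}"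
      using s by (auto simp: ij)
    show "(case case s of (i, j) \<Rightarrow> (i, j - 1) of (i, j) \<Rightarrow> u - mps_const (a (int j - int i + 1))) =
        square_factor a \<nu> u v s"
      using s(3) by (simp add: ij square_factor_def algebra_simps del: has_left.simps)
  next
    fix t assume "t \<in> {(i, j). (i, j) \<in> \<kappa> \<and> (i, Suc j) \<in> \<kappa>}"
    then obtain i j where ij: "t = (i, j)" "(i, j) \<in> \<kappa>" "(i, Suc j) \<in> \<kappa>" by auto
    show "(case case t of (i, j) \<Rightarrow> (i, Suc j) of (i, j) \<Rightarrow> (i, j - 1)) = t"
      "(case t of (i, j) \<Rightarrow> (i, Suc j)) \<in> L"
      using ij nb(2)[OF ij(3)] by (auto simp: L_def)
  qed
  also have "(\<Prod>s\<in>B. square_factor a \<nu> u v s) =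
      (\<Prod>(i, j)\<in>{(i, j). (i, j) \<in> \<kappa> \<and> (Suc i, j) \<in> \<kappa>}. v + mps_const (a (int j - int i)))"
  proof (rule prod.cong)
    show "B = {(i, j). (i, j) \<in> \<kappa> \<and> (Suc i, j) \<in> \<kappa>}"
      using nb(3) by (force simp: B_def)
    fix s assume "s \<in> {(i, j). (i, j) \<in> \<kappa> \<and> (Suc i, j) \<in> \<kappa>}"
    then obtain i j where ij: "s = (i, j)" "(i, j) \<in> \<kappa>" "(Suc i, j) \<in> \<kappa>" by auto
    then have "s \<in> B" using nb(3)[OF ij(2)] by (auto simp: B_def)
    with LB have "has_below \<nu> s" "\<not> has_left \<nu> s" by (auto simp: B_def L_def)
    then show "square_factor a \<nu> u v s = (case s of (i, j) \<Rightarrow> v + mps_const (a (int j - int i)))"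
      by (simp add: ij(1) square_factor_def del: has_left.simps has_below.simps)
  qed
  finally show ?thesis by (simp add: f_connected_def mult.assoc)
qed

text \<open>
  Neighbours always lie in the same component, so the factor of a square can be read off from the whole
  diagram and the components need no longer be mentioned.
\<close>

lemma f_skew_eq_prod_squares:
  assumes fin: "finite \<nu>" and cf: "corner_free \<nu>"
  shows "f_skew a \<nu> u v = (\<Prod>s\<in>\<nu>. square_factor a \<nu> u v s)"
proof -
  have un: "\<Union> (diagram_components \<nu>) = \<nu>"
    using component_subset by (auto simp: diagram_components_def)
  have "(\<Prod>s\<in>\<Union> (diagram_components \<nu>). square_factor a \<nu> u v s) =
      (\<Prod>\<kappa>\<in>diagram_components \<nu>. \<Prod>s\<in>\<kappa>. square_factor a \<nu> u v s)"
  proof (subst prod.Union_disjoint)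
    show "\<forall>\<kappa>\<in>diagram_components \<nu>. finite \<kappa>"
    proof
      fix \<kappa> assume "\<kappa> \<in> diagram_components \<nu>"
      then have "\<kappa> \<subseteq> \<nu>" using Union_upper un by metis
      with fin show "finite \<kappa>" by (rule finite_subset[rotated])
    qed
    show "\<forall>\<kappa>\<in>diagram_components \<nu>. \<forall>\<kappa>'\<in>diagram_components \<nu>. \<kappa> \<noteq> \<kappa>' \<longrightarrow> \<kappa> \<inter> \<kappa>' = {}"
    proof (intro ballI impI, rule ccontr)
      fix \<kappa> \<kappa>' assume *: "\<kappa> \<in> diagram_components \<nu>" "\<kappa>' \<in> diagram_components \<nu>" "\<kappa> \<noteq> \<kappa>'" "\<kappa> \<inter> \<kappa>' \<noteq> {}"
      then obtain s where "s \<in> \<kappa>" "s \<in> \<kappa>'" by blast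
      with *(1,2) have "\<kappa> = \<kappa>'"
        using component_closed component_connected by (meson subset_antisym subsetI)
      with *(3) show False ..
    qed
  qed simp
  then show ?thesis
    unfolding un f_skew_def by (simp add: f_connected_component[OF assms])
qed

definition fibre :: "nat list \<Rightarrow> (nat \<times> nat \<Rightarrow> nat) \<Rightarrow> nat \<times> nat \<Rightarrow> (nat \<times> nat) set" where
  "fibre \<mu> T s = {t \<in> diagram \<mu>. T t = T s}"

lemma finite_diagram: "finite (diagram \<mu>)"
proof (rule finite_subset)
  show "diagram \<mu> \<subseteq> (SIGMA i:{1..length \<mu>}. {1..part \<mu> i})"
    by (auto simp: diagram_def part_def split: if_splits)
qed auto

lemma fibre_corner_free:
  assumes "T \<in> diagonal_strict_tableaux \<mu>" shows "corner_free {t \<in> diagram \<mu>. T t = k}"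
  unfolding corner_free_def
proof (intro ballI notI)
  fix s assume s: "s \<in> {t \<in> diagram \<mu>. T t = k}"
    "has_left {t \<in> diagram \<mu>. T t = k} s \<and> has_below {t \<in> diagram \<mu>. T t = k} s"
  obtain i j where ij: "s = (i, j)" by (cases s)
  have strict: "T t < T t'" if "t \<in> diagram \<mu>" "t' \<in> diagram \<mu>" "content t = content t'" "fst t < fst t'" for t t'
    using assms that by (auto simp: diagonal_strict_tableaux_def)
  have "T (i, j - 1) < T (Suc i, j)"
    using s by (intro strict) (auto simp: ij of_nat_diff)
  then show False using s by (simp add: ij)
qed

lemma diagonal_strict_weight_eq_prod_squares:
  assumes "T \<in> diagonal_strict_tableaux \<mu>"
  shows "diagonal_strict_weight a \<mu> x y T =
    (\<Prod>s\<in>diagram \<mu>. square_factor a (fibre \<mu> T s) (x (T s)) (y (T s)) s)"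
proof -
  have "(\<Prod>s\<in>diagram \<mu>. square_factor a (fibre \<mu> T s) (x (T s)) (y (T s)) s) =
      (\<Prod>k\<in>T ` diagram \<mu>. \<Prod>s\<in>{s \<in> diagram \<mu>. T s = k}. square_factor a (fibre \<mu> T s) (x (T s)) (y (T s)) s)"
    by (rule prod.image_gen) (rule finite_diagram)
  also have "\<dots> = diagonal_strict_weight a \<mu> x y T"
    unfolding diagonal_strict_weight_def
  proof (rule prod.cong)
    fix k
    have "finite {s \<in> diagram \<mu>. T s = k}" using finite_diagram by simp
    from f_skew_eq_prod_squares[OF this fibre_corner_free[OF assms], of a "x k" "y k"]
    show "(\<Prod>s\<in>{s \<in> diagram \<mu>. T s = k}. square_factor a (fibre \<mu> T s) (x (T s)) (y (T s)) s) =
        f_skew a {s \<in> diagram \<mu>. T s = k} (x k) (y k)"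
      by (auto simp: fibre_def)
  qed simp
  finally show ?thesis ..
qed

section \<open>The formula for letter tableaux\<close>

definition letter_factor ::
    "(int \<Rightarrow> complex) \<Rightarrow> (nat \<Rightarrow> 'v mps) \<Rightarrow> (nat \<Rightarrow> 'v mps) \<Rightarrow> letter \<Rightarrow> nat \<times> nat \<Rightarrow> 'v mps" where
  "letter_factor a x y L s = (case L of
      Primed k \<Rightarrow> y k + mps_const (a (content s))
    | Unprimed k \<Rightarrow> x k - mps_const (a (content s)))"

lemma letter_weight_eq_prod:
  assumes "T \<in> letter_tableaux \<mu> n"
  shows "letter_weight a \<mu> n x y T = (\<Prod>s\<in>diagram \<mu>. letter_factor a x y (T s) s)"
proof -
  have T: "T s \<in> letters_upto n" if "s \<in> diagram \<mu>" for s
    using assms that by (auto simp: letter_tableaux_def)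
  let ?U = "{s \<in> diagram \<mu>. T s \<in> Unprimed ` {1..n}}" and ?P = "{s \<in> diagram \<mu>. T s \<in> Primed ` {1..n}}"
  have "diagram \<mu> = ?U \<union> ?P" using T by (auto simp: letters_upto_def)
  then have "(\<Prod>s\<in>diagram \<mu>. letter_factor a x y (T s) s) = (\<Prod>s\<in>?U \<union> ?P. letter_factor a x y (T s) s)"
    by simp
  also have "\<dots> = (\<Prod>s\<in>?U. letter_factor a x y (T s) s) * (\<Prod>s\<in>?P. letter_factor a x y (T s) s)"
    using finite_diagram[of \<mu>] by (intro prod.union_disjoint) auto
  also have "\<dots> = letter_weight a \<mu> n x y T"
    unfolding letter_weight_def
    by (intro arg_cong2[where f = "(*)"] prod.cong) (auto simp: letter_factor_def)
  finally show ?thesis ..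
qed

lemma mps_coeff_sum: "mps_coeff (\<Sum>i\<in>I. F i) m = (\<Sum>i\<in>I. mps_coeff (F i) m)"
  by (induction I rule: infinite_finite_induct) (simp_all add: mps_ring_defs)

lemma infsum_zero_above_power:
  fixes z :: "nat \<Rightarrow> super_mps"
  assumes "0 < k"
  shows "mps_infsum (\<lambda>i. zero_above n z i ^ k) {1..} = (\<Sum>i=1..n. z i ^ k)"
proof (rule mps_eqI)
  fix m
  let ?c = "\<lambda>i. mps_coeff (zero_above n z i ^ k) m"
  have zero: "?c i = 0" if "n < i" for i
  proof -
    have "zero_above n z i ^ k = 0" using assms that by (simp add: zero_above_def zero_power)
    then show ?thesis by (simp add: zero_mps_def)
  qed
  have "mps_coeff (mps_infsum (\<lambda>i. zero_above n z i ^ k) {1..}) m = (\<Sum>i\<in>{i \<in> {1..}. ?c i \<noteq> 0}. ?c i)"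
    by (simp add: mps_infsum_def)
  also have "\<dots> = (\<Sum>i\<in>{1..n}. ?c i)"
    using zero by (intro sum.mono_neutral_left) (auto simp: not_less[symmetric])
  also have "\<dots> = (\<Sum>i\<in>{1..n}. mps_coeff (z i ^ k) m)"
    by (intro sum.cong) (auto simp: zero_above_def)
  finally show "mps_coeff (mps_infsum (\<lambda>i. zero_above n z i ^ k) {1..}) m = mps_coeff (\<Sum>i=1..n. z i ^ k) m"
    by (simp add: mps_coeff_sum)
qed

lemma super_psum_zero_above:
  "super_psum (zero_above n x) (zero_above n y) (Suc k) =
     (\<Sum>i=1..n. x i ^ Suc k) + (- 1) ^ k * (\<Sum>i=1..n. y i ^ Suc k)"
  unfolding super_psum_def by (subst (1 2) infsum_zero_above_power) simp_all

text \<open>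
  One step of the induction adjoins the letters \<open>n+1\<close>, primed and unprimed, to the alphabet and the pair of
  variables with index \<open>n+1\<close> to the Schur function; both sides obey the same recursion over strips.
\<close>

lemma schur_eq_sum_tableaux_over:
  assumes "p \<in> shapes N"
  shows "beta_det N (newton_matrix a (zero_above n x) (zero_above n y)) p =
    (\<Sum>T\<in>tableaux_over (letters_upto n) p. \<Prod>s\<in>squares p. letter_factor a x y (T s) s)"
  using assms
proof (induction n arbitrary: p)
  case 0
  have "super_psum (zero_above 0 x) (zero_above 0 y) (Suc k) = 0" for k
    unfolding super_psum_zero_above by simp
  from schur_no_variables[OF this 0] show ?case
    using sum_tableaux_empty_alphabet[OF 0, of "letter_factor a x y"] by (simp add: letters_upto_def)
next
  case (Suc n)
  let ?P = "Primed (Suc n)" and ?U = "Unprimed (Suc n)" and ?w = "letter_factor a x y"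
  have psum: "super_psum (zero_above (Suc n) x) (zero_above (Suc n) y) (Suc k) =
      super_psum (zero_above n x) (zero_above n y) (Suc k) + x (Suc n) ^ Suc k + (- 1) ^ k * y (Suc n) ^ Suc k" for k
    unfolding super_psum_zero_above by (simp add: algebra_simps)
  have wU: "?w ?U s = x (Suc n) - mps_const (a (content s))"
    and wP: "?w ?P s = y (Suc n) + mps_const (a (content s))" for s
    by (simp_all add: letter_factor_def)
  have "(\<Sum>T\<in>tableaux_over (letters_upto (Suc n)) p. \<Prod>s\<in>squares p. ?w (T s) s) =
      (\<Sum>q\<in>horizontal_below p. (\<Prod>s\<in>squares p - squares q. ?w ?U s) *
        (\<Sum>T\<in>tableaux_over (insert ?P (letters_upto n)) q. \<Prod>s\<in>squares q. ?w (T s) s))"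
    unfolding letters_upto_Suc
    using sum_tableaux_insert[where A = "insert ?P (letters_upto n)" and L = ?U and w = ?w, OF Suc.prems letters_upto_less(2)] finite_letters_upto
    by (simp add: strips_below_def)
  also have "\<dots> = (\<Sum>q\<in>horizontal_below p. (\<Prod>s\<in>squares p - squares q. ?w ?U s) *
        (\<Sum>r\<in>vertical_below q. (\<Prod>s\<in>squares q - squares r. ?w ?P s) *
          beta_det N (newton_matrix a (zero_above n x) (zero_above n y)) r))"
  proof (intro sum.cong refl arg_cong2[where f = "(*)"])
    fix q assume "q \<in> horizontal_below p"
    with Suc.prems have q: "q \<in> shapes N" by (rule horizontal_below_shapes)
    have "(\<Sum>T\<in>tableaux_over (insert ?P (letters_upto n)) q. \<Prod>s\<in>squares q. ?w (T s) s) =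
        (\<Sum>r\<in>vertical_below q. (\<Prod>s\<in>squares q - squares r. ?w ?P s) *
          (\<Sum>T\<in>tableaux_over (letters_upto n) r. \<Prod>s\<in>squares r. ?w (T s) s))"
      using sum_tableaux_insert[where A = "letters_upto n" and L = ?P and w = ?w, OF q letters_upto_less(1)] finite_letters_upto
      by (simp add: strips_below_def)
    also have "\<dots> = (\<Sum>r\<in>vertical_below q. (\<Prod>s\<in>squares q - squares r. ?w ?P s) *
          beta_det N (newton_matrix a (zero_above n x) (zero_above n y)) r)"
      using vertical_below_shapes[OF q] by (intro sum.cong refl arg_cong2[where f = "(*)"] Suc.IH[symmetric])
    finally show "(\<Sum>T\<in>tableaux_over (insert ?P (letters_upto n)) q. \<Prod>s\<in>squares q. ?w (T s) s) =
        (\<Sum>r\<in>vertical_below q. (\<Prod>s\<in>squares q - squares r. ?w ?P s) *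
          beta_det N (newton_matrix a (zero_above n x) (zero_above n y)) r)" .
  qed
  also have "\<dots> = beta_det N (newton_matrix a (zero_above (Suc n) x) (zero_above (Suc n) y)) p"
    unfolding wU wP by (rule schur_branching[OF psum Suc.prems, symmetric])
  finally show ?case ..
qed

lemma super_eval_schur_letter_tableaux:
  assumes "is_partition \<mu>" "length \<mu> \<le> N"
  shows "super_eval (zero_above n x) (zero_above n y) (multi_schur N \<mu> a) =
    (\<Sum>T\<in>letter_tableaux \<mu> n. \<Prod>s\<in>diagram \<mu>. letter_factor a x y (T s) s)"
  unfolding super_eval_multi_schur schur_eq_sum_tableaux_over[OF part_shapes[OF assms]]
    letter_tableaux_eq_tableaux_over[OF finite_diagram] diagram_eq_squares ..

section \<open>Forgetting primes\<close>

text \<open>The possible letters of a square in the letter tableaux with prescribed absolute values \<open>T\<close>.\<close>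

definition letter_choices :: "nat list \<Rightarrow> (nat \<times> nat \<Rightarrow> nat) \<Rightarrow> nat \<times> nat \<Rightarrow> letter set" where
  "letter_choices \<mu> T s =
     (if has_left (fibre \<mu> T s) s then {Unprimed (T s)}
      else if has_below (fibre \<mu> T s) s then {Primed (T s)}
      else {Primed (T s), Unprimed (T s)})"

lemma sum_letter_choices:
  "(\<Sum>L\<in>letter_choices \<mu> T s. letter_factor a x y L s) = square_factor a (fibre \<mu> T s) (x (T s)) (y (T s)) s"
  by (simp add: letter_choices_def letter_factor_def square_factor_def del: has_left.simps has_below.simps)

definition absolute_tableau :: "nat list \<Rightarrow> (nat \<times> nat \<Rightarrow> letter) \<Rightarrow> nat \<times> nat \<Rightarrow> nat" where
  "absolute_tableau \<mu> T = (\<lambda>s\<in>diagram \<mu>. letter_abs (T s))"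

lemma letter_abs_mono: "K \<le> L \<Longrightarrow> letter_abs K \<le> letter_abs L"
  by (cases K; cases L) (auto simp: less_eq_letter_def)

lemma letter_squeeze:
  "K \<le> Primed k \<Longrightarrow> letter_abs K = k \<Longrightarrow> K = Primed k"
  "Unprimed k \<le> K \<Longrightarrow> letter_abs K = k \<Longrightarrow> K = Unprimed k"
  by (cases K; auto simp: less_eq_letter_def)+

lemma diagram_downward:
  assumes "is_partition \<mu>" "(i', j') \<in> diagram \<mu>" "1 \<le> i" "i \<le> i'" "1 \<le> j" "j \<le> j'"
  shows "(i, j) \<in> diagram \<mu>"
  using shape_antimono[OF part_shapes[OF assms(1) order_refl] assms(3,4)] assms(2-6)
  by (auto simp: diagram_def)

lemma letter_tableauxD:
  assumes "T \<in> letter_tableaux \<mu> n"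
  shows "s \<in> diagram \<mu> \<Longrightarrow> T s \<in> letters_upto n"
    and "s \<notin> diagram \<mu> \<Longrightarrow> T s = undefined"
    and "(i, j) \<in> diagram \<mu> \<Longrightarrow> (i, j') \<in> diagram \<mu> \<Longrightarrow> j \<le> j' \<Longrightarrow> T (i, j) \<le> T (i, j')"
    and "(i, j) \<in> diagram \<mu> \<Longrightarrow> (i', j) \<in> diagram \<mu> \<Longrightarrow> i \<le> i' \<Longrightarrow> T (i, j) \<le> T (i', j)"
    and "(i, j) \<in> diagram \<mu> \<Longrightarrow> (i, j') \<in> diagram \<mu> \<Longrightarrow> T (i, j) = Primed k \<Longrightarrow> T (i, j') = Primed k \<Longrightarrow> j = j'"
    and "(i, j) \<in> diagram \<mu> \<Longrightarrow> (i', j) \<in> diagram \<mu> \<Longrightarrow> T (i, j) = Unprimed k \<Longrightarrow> T (i', j) = Unprimed k \<Longrightarrow> i = i'"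
proof -
  note D = tableaux_overD[OF assms[unfolded letter_tableaux_eq_tableaux_over[OF finite_diagram]], folded diagram_eq_squares]
  show "s \<in> diagram \<mu> \<Longrightarrow> T s \<in> letters_upto n" "s \<notin> diagram \<mu> \<Longrightarrow> T s = undefined"
    "(i, j) \<in> diagram \<mu> \<Longrightarrow> (i, j') \<in> diagram \<mu> \<Longrightarrow> j \<le> j' \<Longrightarrow> T (i, j) \<le> T (i, j')"
    "(i, j) \<in> diagram \<mu> \<Longrightarrow> (i', j) \<in> diagram \<mu> \<Longrightarrow> i \<le> i' \<Longrightarrow> T (i, j) \<le> T (i', j)"
    by (rule D; assumption)+
  show "(i, j) \<in> diagram \<mu> \<Longrightarrow> (i, j') \<in> diagram \<mu> \<Longrightarrow> T (i, j) = Primed k \<Longrightarrow> T (i, j') = Primed k \<Longrightarrow> j = j'"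
    using D(5)[of "(i, j)" "(i, j')"] by auto
  show "(i, j) \<in> diagram \<mu> \<Longrightarrow> (i', j) \<in> diagram \<mu> \<Longrightarrow> T (i, j) = Unprimed k \<Longrightarrow> T (i', j) = Unprimed k \<Longrightarrow> i = i'"
    using D(6)[of "(i, j)" "(i', j)"] by auto
qed

text \<open>
  Suppose \<open>(i, j)\<close> and \<open>(i+1, j+1)\<close> both had absolute value \<open>k\<close>. Then so has \<open>(i, j+1)\<close>; if its
  letter is \<open>k'\<close> then \<open>k'\<close> occurs twice in row \<open>i\<close>, and if it is \<open>k\<close> then \<open>k\<close> occurs twice in column \<open>j+1\<close>.
\<close>

lemma absolute_tableau_diagonal_strict:
  assumes \<mu>: "is_partition \<mu>" and T: "T \<in> letter_tableaux \<mu> n"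
  shows "absolute_tableau \<mu> T \<in> diagonal_strict_tableaux \<mu>"
    and "absolute_tableau \<mu> T ` diagram \<mu> \<subseteq> {1..n}"
proof -
  have range: "letter_abs (T s) \<in> {1..n}" if "s \<in> diagram \<mu>" for s
    using letter_tableauxD(1)[OF T that] by (auto simp: letters_upto_def)
  then show "absolute_tableau \<mu> T ` diagram \<mu> \<subseteq> {1..n}" by (auto simp: absolute_tableau_def)
  have strict: "letter_abs (T (i, j)) < letter_abs (T (i', j'))"
    if st: "(i, j) \<in> diagram \<mu>" "(i', j') \<in> diagram \<mu>" "i < i'" "j < j'" for i j i' j'
  proof -
    have pos: "1 \<le> i" "1 \<le> j" using st(1) by (auto simp: diagram_def)
    have s1: "(i, Suc j) \<in> diagram \<mu>" and s2: "(Suc i, Suc j) \<in> diagram \<mu>" and s3: "(Suc i, j') \<in> diagram \<mu>"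
      using st pos by (auto intro: diagram_downward[OF \<mu> st(2)])
    have le1: "T (i, j) \<le> T (i, Suc j)" using letter_tableauxD(3)[OF T st(1) s1] by simp
    have le2: "T (i, Suc j) \<le> T (Suc i, Suc j)" using letter_tableauxD(4)[OF T s1 s2] by simp
    have le3: "T (Suc i, Suc j) \<le> T (Suc i, j')" "T (Suc i, j') \<le> T (i', j')"
      using letter_tableauxD(3)[OF T s2 s3] letter_tableauxD(4)[OF T s3 st(2)] st by simp_all
    note abs = letter_abs_mono[OF le1] letter_abs_mono[OF le2] letter_abs_mono[OF le3(1)] letter_abs_mono[OF le3(2)]
    have "letter_abs (T (i, j)) \<noteq> letter_abs (T (Suc i, Suc j))"
    proof
      assume eq: "letter_abs (T (i, j)) = letter_abs (T (Suc i, Suc j))"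
      show False
      proof (cases "T (i, Suc j)")
        case (Primed k)
        with abs eq have "T (i, j) = Primed k"
          using le1 by (intro letter_squeeze(1)) auto
        from letter_tableauxD(5)[OF T st(1) s1 this Primed] show False by simp
      next
        case (Unprimed k)
        with abs eq have "T (Suc i, Suc j) = Unprimed k"
          using le2 by (intro letter_squeeze(2)) auto
        from letter_tableauxD(6)[OF T s1 s2 Unprimed this] show False by simp
      qed
    qed
    with abs show ?thesis by linarith
  qed
  have "absolute_tableau \<mu> T \<in> diagram \<mu> \<rightarrow>\<^sub>E {1..}"
    using range by (auto simp: absolute_tableau_def)
  moreover have "weakly_increasing (diagram \<mu>) (absolute_tableau \<mu> T)"
    unfolding weakly_increasing_def absolute_tableau_def
    using letter_tableauxD(3,4)[OF T] letter_abs_mono by simp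
  moreover have "absolute_tableau \<mu> T s < absolute_tableau \<mu> T t"
    if "s \<in> diagram \<mu>" "t \<in> diagram \<mu>" "content s = content t" "fst s < fst t" for s t
  proof -
    obtain i j i' j' where "s = (i, j)" "t = (i', j')" by (cases s; cases t)
    with that strict[of i j i' j'] show ?thesis by (simp add: absolute_tableau_def)
  qed
  ultimately show "absolute_tableau \<mu> T \<in> diagonal_strict_tableaux \<mu>"
    by (simp add: diagonal_strict_tableaux_def)
qed

text \<open>
  The letters of the individual squares can be chosen independently: whenever two squares in a row or column
  have the same absolute value, so do all squares between them, and the neighbour rules alone
  already enforce the order and the conditions on repetitions.
\<close>

lemma letter_tableaux_over_diagonal_strict:
  assumes \<mu>: "is_partition \<mu>" and \<T>: "\<T> \<in> diagonal_strict_tableaux \<mu>" "\<T> ` diagram \<mu> \<subseteq> {1..n}"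
  shows "{T \<in> letter_tableaux \<mu> n. absolute_tableau \<mu> T = \<T>} = Pi\<^sub>E (diagram \<mu>) (letter_choices \<mu> \<T>)"
proof (rule equalityI; rule subsetI)
  fix T assume "T \<in> {T \<in> letter_tableaux \<mu> n. absolute_tableau \<mu> T = \<T>}"
  then have T: "T \<in> letter_tableaux \<mu> n" and abs: "absolute_tableau \<mu> T = \<T>" by auto
  have absD: "letter_abs (T s) = \<T> s" if "s \<in> diagram \<mu>" for s
    using that by (simp add: abs[symmetric] absolute_tableau_def)
  have "T s \<in> letter_choices \<mu> \<T> s" if s: "s \<in> diagram \<mu>" for s
  proof -
    obtain i j where ij: "s = (i, j)" by (cases s)
    have either: "T s \<in> {Primed (\<T> s), Unprimed (\<T> s)}"
      using absD[OF s] by (cases "T s") auto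
    have "T s \<noteq> Primed (\<T> s)" if "has_left (fibre \<mu> \<T> s) s"
    proof
      assume P: "T s = Primed (\<T> s)"
      from that have l: "0 < j" "(i, j - 1) \<in> diagram \<mu>" "\<T> (i, j - 1) = \<T> s" by (auto simp: ij fibre_def)
      then have "T (i, j - 1) = Primed (\<T> s)"
        using letter_tableauxD(3)[OF T l(2) s[unfolded ij]] P absD[OF l(2)]
        by (intro letter_squeeze(1)) (auto simp: ij)
      from letter_tableauxD(5)[OF T l(2) s[unfolded ij] this] P l(1) show False by (simp add: ij)
    qed
    moreover have "T s \<noteq> Unprimed (\<T> s)" if "has_below (fibre \<mu> \<T> s) s"
    proof
      assume U: "T s = Unprimed (\<T> s)"
      from that have b: "(Suc i, j) \<in> diagram \<mu>" "\<T> (Suc i, j) = \<T> s" by (auto simp: ij fibre_def)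
      then have "T (Suc i, j) = Unprimed (\<T> s)"
        using letter_tableauxD(4)[OF T s[unfolded ij] b(1)] U absD[OF b(1)]
        by (intro letter_squeeze(2)) (auto simp: ij)
      from letter_tableauxD(6)[OF T s[unfolded ij] b(1) _ this] U show False by (simp add: ij)
    qed
    ultimately show ?thesis using either by (auto simp: letter_choices_def simp del: has_left.simps has_below.simps)
  qed
  moreover have "T s = undefined" if "s \<notin> diagram \<mu>" for s using letter_tableauxD(2)[OF T that] .
  ultimately show "T \<in> Pi\<^sub>E (diagram \<mu>) (letter_choices \<mu> \<T>)" by auto
next
  fix T assume T: "T \<in> Pi\<^sub>E (diagram \<mu>) (letter_choices \<mu> \<T>)"
  have choice: "T s \<in> letter_choices \<mu> \<T> s" if "s \<in> diagram \<mu>" for s using T that by auto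
  have absD: "letter_abs (T s) = \<T> s" if "s \<in> diagram \<mu>" for s
    using choice[OF that] by (auto simp: letter_choices_def simp del: has_left.simps has_below.simps split: if_splits)
  have mono: "(i, j) \<in> diagram \<mu> \<Longrightarrow> (i, j') \<in> diagram \<mu> \<Longrightarrow> j \<le> j' \<Longrightarrow> \<T> (i, j) \<le> \<T> (i, j')"
    "(i, j) \<in> diagram \<mu> \<Longrightarrow> (i', j) \<in> diagram \<mu> \<Longrightarrow> i \<le> i' \<Longrightarrow> \<T> (i, j) \<le> \<T> (i', j)" for i i' j j'
    using \<T>(1) unfolding diagonal_strict_tableaux_def weakly_increasing_def by blast+
  have right: "T (i, j') = Unprimed (\<T> (i, j'))"
    if st: "(i, j) \<in> diagram \<mu>" "(i, j') \<in> diagram \<mu>" "j < j'" "\<T> (i, j) = \<T> (i, j')" for i j j'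
  proof -
    have "1 \<le> i" "1 \<le> j" using st(1) by (auto simp: diagram_def)
    then have m: "(i, j' - 1) \<in> diagram \<mu>" using st(3) by (intro diagram_downward[OF \<mu> st(2)]) auto
    have "\<T> (i, j' - 1) = \<T> (i, j')"
      using mono(1)[OF st(1) m] mono(1)[OF m st(2)] st by simp
    with m st(3) have "has_left (fibre \<mu> \<T> (i, j')) (i, j')" by (simp add: fibre_def)
    with choice[OF st(2)] show ?thesis by (simp add: letter_choices_def del: has_left.simps has_below.simps)
  qed
  have below: "T (i, j) = Primed (\<T> (i, j))"
    if st: "(i, j) \<in> diagram \<mu>" "(i', j) \<in> diagram \<mu>" "i < i'" "\<T> (i, j) = \<T> (i', j)" for i i' j
  proof -
    have "1 \<le> i" "1 \<le> j" using st(1) by (auto simp: diagram_def)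
    then have m: "(Suc i, j) \<in> diagram \<mu>" using st(3) by (intro diagram_downward[OF \<mu> st(2)]) auto
    have "\<T> (Suc i, j) = \<T> (i, j)"
      using mono(2)[OF st(1) m] mono(2)[OF m st(2)] st by simp
    with m have hb: "has_below (fibre \<mu> \<T> (i, j)) (i, j)" by (simp add: fibre_def)
    have "(i, j) \<in> fibre \<mu> \<T> (i, j)" using st(1) by (simp add: fibre_def)
    with hb fibre_corner_free[OF \<T>(1), of "\<T> (i, j)"] have "\<not> has_left (fibre \<mu> \<T> (i, j)) (i, j)"
      unfolding corner_free_def fibre_def by blast
    with hb choice[OF st(1)] show ?thesis by (simp add: letter_choices_def del: has_left.simps has_below.simps)
  qed
  have abs: "absolute_tableau \<mu> T = \<T>"
    using \<T>(1) absD by (auto simp: fun_eq_iff absolute_tableau_def restrict_def diagonal_strict_tableaux_def)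
  have letters: "T s \<in> letters_upto n" if "s \<in> diagram \<mu>" for s
    using \<T>(2) absD[OF that] that by (cases "T s") (auto simp: letters_upto_def)
  have rank: "K < L" if "letter_abs K < letter_abs L" for K L
    using that by (cases K; cases L) (auto simp: less_letter_def)
  have row: "T (i, j) \<le> T (i, j')" if st: "(i, j) \<in> diagram \<mu>" "(i, j') \<in> diagram \<mu>" "j \<le> j'" for i j j'
  proof (cases "j = j' \<or> \<T> (i, j) < \<T> (i, j')")
    case True then show ?thesis using rank[of "T (i, j)" "T (i, j')"] absD[OF st(1)] absD[OF st(2)] by auto
  next
    case False
    then have "\<T> (i, j) = \<T> (i, j')" "j < j'" using mono(1)[OF st] st by auto
    with right[OF st(1,2)] absD[OF st(1)] show ?thesis
      by (cases "T (i, j)") (auto simp: less_eq_letter_def)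
  qed
  have col: "T (i, j) \<le> T (i', j)" if st: "(i, j) \<in> diagram \<mu>" "(i', j) \<in> diagram \<mu>" "i \<le> i'" for i i' j
  proof (cases "i = i' \<or> \<T> (i, j) < \<T> (i', j)")
    case True then show ?thesis using rank[of "T (i, j)" "T (i', j)"] absD[OF st(1)] absD[OF st(2)] by auto
  next
    case False
    then have "\<T> (i, j) = \<T> (i', j)" "i < i'" using mono(2)[OF st] st by auto
    with below[OF st(1,2)] absD[OF st(2)] show ?thesis
      by (cases "T (i', j)") (auto simp: less_eq_letter_def)
  qed
  have "j = j'" if st: "(i, j) \<in> diagram \<mu>" "(i, j') \<in> diagram \<mu>" "T (i, j) = Primed k" "T (i, j') = Primed k" for i j j' k
    using right[OF st(1,2)] right[OF st(2,1)] absD[OF st(1)] absD[OF st(2)] st(3,4) by (cases j j' rule: linorder_cases) auto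
  then have primed: "card {s \<in> diagram \<mu>. fst s = r \<and> T s = Primed k} \<le> 1" for k r
    using finite_diagram[of \<mu>] by (subst card_le_one_iff) auto
  have "i = i'" if st: "(i, j) \<in> diagram \<mu>" "(i', j) \<in> diagram \<mu>" "T (i, j) = Unprimed k" "T (i', j) = Unprimed k" for i i' j k
    using below[OF st(1,2)] below[OF st(2,1)] absD[OF st(1)] absD[OF st(2)] st(3,4) by (cases i i' rule: linorder_cases) auto
  then have unprimed: "card {s \<in> diagram \<mu>. snd s = c \<and> T s = Unprimed k} \<le> 1" for k c
    using finite_diagram[of \<mu>] by (subst card_le_one_iff) auto
  have "T \<in> diagram \<mu> \<rightarrow>\<^sub>E letters_upto n" using T letters by auto
  moreover have "weakly_increasing (diagram \<mu>) T" unfolding weakly_increasing_def using row col by blast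
  ultimately show "T \<in> {T \<in> letter_tableaux \<mu> n. absolute_tableau \<mu> T = \<T>}"
    using abs primed unprimed by (simp add: letter_tableaux_def)
qed

lemma finite_diagonal_strict_upto:
  "finite {T \<in> diagonal_strict_tableaux \<mu>. T ` diagram \<mu> \<subseteq> {1..n}}"
proof (rule finite_subset)
  show "{T \<in> diagonal_strict_tableaux \<mu>. T ` diagram \<mu> \<subseteq> {1..n}} \<subseteq> diagram \<mu> \<rightarrow>\<^sub>E {1..n}"
    by (auto simp: diagonal_strict_tableaux_def)
qed (use finite_diagram in \<open>auto intro!: finite_PiE\<close>)

lemma sum_letter_tableaux_eq_diagonal_strict:
  assumes \<mu>: "is_partition \<mu>"
  shows "(\<Sum>T\<in>letter_tableaux \<mu> n. \<Prod>s\<in>diagram \<mu>. letter_factor a x y (T s) s) =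
    (\<Sum>T\<in>{T \<in> diagonal_strict_tableaux \<mu>. T ` diagram \<mu> \<subseteq> {1..n}}. diagonal_strict_weight a \<mu> x y T)"
proof -
  let ?D = "{T \<in> diagonal_strict_tableaux \<mu>. T ` diagram \<mu> \<subseteq> {1..n}}"
  let ?w = "\<lambda>T. \<Prod>s\<in>diagram \<mu>. letter_factor a x y (T s) s"
  have "finite (letter_tableaux \<mu> n)"
    unfolding letter_tableaux_eq_tableaux_over[OF finite_diagram]
    by (intro finite_tableaux_over[OF part_shapes[OF \<mu> order_refl] finite_letters_upto])
  then have "(\<Sum>T\<in>letter_tableaux \<mu> n. ?w T) = (\<Sum>\<T>\<in>?D. sum ?w {T \<in> letter_tableaux \<mu> n. absolute_tableau \<mu> T = \<T>})"
    by (intro sum.group[symmetric] finite_diagonal_strict_upto image_subsetI CollectI conjI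
          absolute_tableau_diagonal_strict[OF \<mu>])
  also have "\<dots> = (\<Sum>\<T>\<in>?D. diagonal_strict_weight a \<mu> x y \<T>)"
  proof (rule sum.cong)
    fix \<T> assume "\<T> \<in> ?D"
    then have \<T>: "\<T> \<in> diagonal_strict_tableaux \<mu>" "\<T> ` diagram \<mu> \<subseteq> {1..n}" by auto
    have "sum ?w {T \<in> letter_tableaux \<mu> n. absolute_tableau \<mu> T = \<T>} =
        (\<Sum>T\<in>Pi\<^sub>E (diagram \<mu>) (letter_choices \<mu> \<T>). ?w T)"
      by (simp only: letter_tableaux_over_diagonal_strict[OF \<mu> \<T>])
    also have "\<dots> = (\<Prod>s\<in>diagram \<mu>. \<Sum>L\<in>letter_choices \<mu> \<T> s. letter_factor a x y L s)"
      by (rule prod_sum_PiE[symmetric]) (auto simp: finite_diagram letter_choices_def)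
    finally show "sum ?w {T \<in> letter_tableaux \<mu> n. absolute_tableau \<mu> T = \<T>} = diagonal_strict_weight a \<mu> x y \<T>"
      unfolding sum_letter_choices diagonal_strict_weight_eq_prod_squares[OF \<T>(1)] .
  qed simp
  finally show ?thesis .
qed

section \<open>Infinitely many variables\<close>

definition var_index :: "nat + nat \<Rightarrow> nat" where
  "var_index = case_sum id id"

text \<open>Setting all variables with index larger than \<open>n\<close> to zero.\<close>

definition truncate :: "nat \<Rightarrow> super_mps \<Rightarrow> super_mps" where
  "truncate n f = Abs_mps (\<lambda>m. if \<forall>v\<in>Poly_Mapping.keys m. var_index v \<le> n then mps_coeff f m else 0)"

text \<open>
  A product of monomials involves only variables of index at most \<open>n\<close> iff both factors do; therefore
  discarding all other monomials is compatible with products.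
\<close>

lemma truncate_hom: "comm_ring_hom (truncate n)"
proof
  fix f g :: super_mps
  show "truncate n 0 = 0" "truncate n 1 = 1" "truncate n (f + g) = truncate n f + truncate n g"
    by (rule mps_eqI, simp add: truncate_def mps_ring_defs)+
  show "truncate n (f * g) = truncate n f * truncate n g"
  proof (rule mps_eqI)
    fix m
    define ok where "ok m \<longleftrightarrow> (\<forall>v\<in>Poly_Mapping.keys m. var_index v \<le> n)"
      for m :: "nat + nat \<Rightarrow>\<^sub>0 nat"
    have ok: "ok (r + s) \<longleftrightarrow> ok r \<and> ok s" for r s
      by (auto simp: ok_def in_keys_iff lookup_add)
    have "(if ok m then \<Sum>(r, s)\<in>{(r, s). r + s = m}. mps_coeff f r * mps_coeff g s else 0) =
        (\<Sum>(r, s)\<in>{(r, s). r + s = m}. (if ok r then mps_coeff f r else 0) * (if ok s then mps_coeff g s else 0))"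
    proof (cases "ok m")
      case True
      then have "ok r \<and> ok s" if "r + s = m" for r s using that ok by blast
      then show ?thesis using True by (auto intro!: sum.cong)
    next
      case False
      then have "\<not> (ok r \<and> ok s)" if "r + s = m" for r s using that ok by blast
      then have "(if ok r then mps_coeff f r else 0) * (if ok s then mps_coeff g s else 0) = 0" if "r + s = m" for r s
        using that by auto
      then show ?thesis using False by (simp only: if_False) (intro sum.neutral[symmetric], auto)
    qed
    then show "mps_coeff (truncate n (f * g)) m = mps_coeff (truncate n f * truncate n g) m"
      by (simp only: truncate_def times_mps_def mps_coeff_Abs ok_def)
  qed
qed

lemma truncate_const: "truncate n (mps_const c) = mps_const c"
  by (rule mps_eqI) (simp add: truncate_def mps_const_def)

lemma truncate_vars: "truncate n (xvar i) = zero_above n xvar i" "truncate n (yvar i) = zero_above n yvar i"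
  by (rule mps_eqI, auto simp: truncate_def xvar_def yvar_def zero_above_def mps_var_def mps_monom_def
        zero_mps_def var_index_def)+

lemma truncate_infsum: "truncate n (mps_infsum F I) = mps_infsum (\<lambda>i. truncate n (F i)) I"
  by (rule mps_eqI) (simp add: truncate_def mps_infsum_def)

lemma truncate_super_eval:
  "truncate n (super_eval xvar yvar f) = super_eval (zero_above n xvar) (zero_above n yvar) f"
proof -
  interpret comm_ring_hom "truncate n" by (rule truncate_hom)
  have "truncate n (super_psum xvar yvar k) = super_psum (zero_above n xvar) (zero_above n yvar) k" for k
    by (simp add: super_psum_def hom_distribs truncate_infsum truncate_vars)
  then show ?thesis by (simp add: super_eval_def hom_distribs truncate_const)
qed

lemma truncate_diagonal_strict_weight:
  assumes "T \<in> diagonal_strict_tableaux \<mu>"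
  shows "truncate n (diagonal_strict_weight a \<mu> xvar yvar T) =
    diagonal_strict_weight a \<mu> (zero_above n xvar) (zero_above n yvar) T"
proof -
  interpret comm_ring_hom "truncate n" by (rule truncate_hom)
  have "truncate n (square_factor a \<nu> u v s) = square_factor a \<nu> (truncate n u) (truncate n v) s" for \<nu> u v s
    by (simp add: square_factor_def hom_distribs truncate_const)
  then show ?thesis
    by (simp add: diagonal_strict_weight_eq_prod_squares[OF assms] hom_distribs truncate_vars)
qed

lemma coeff_truncate_large: "\<exists>n. \<forall>f. mps_coeff (truncate n f) m = mps_coeff f m"
proof
  let ?n = "Max (insert 0 (var_index ` Poly_Mapping.keys m))"
  have "\<forall>v\<in>Poly_Mapping.keys m. var_index v \<le> ?n" by (auto intro!: Max_ge)
  then show "\<forall>f. mps_coeff (truncate ?n f) m = mps_coeff f m"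
    unfolding truncate_def mps_coeff_Abs by (simp only: if_P simp_thms)
qed

text \<open>An entry \<open>k > n\<close> has a nonempty fibre, each component of which contributes a factor \<open>x\<^sub>k + y\<^sub>k = 0\<close>.\<close>

lemma diagonal_strict_weight_vanishes:
  assumes T: "T \<in> diagonal_strict_tableaux \<mu>"
    and nz: "diagonal_strict_weight a \<mu> (zero_above n x) (zero_above n y) T \<noteq> 0"
  shows "T ` diagram \<mu> \<subseteq> {1..n}"
proof
  fix k assume k: "k \<in> T ` diagram \<mu>"
  then have "1 \<le> k" using T by (auto simp: diagonal_strict_tableaux_def)
  moreover have "k \<le> n"
  proof (rule ccontr)
    assume "\<not> k \<le> n"
    then have z: "zero_above n x k = 0" "zero_above n y k = 0" by (simp_all add: zero_above_def)
    let ?\<nu> = "{s \<in> diagram \<mu>. T s = k}"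
    have "diagram_components ?\<nu> \<noteq> {}" "finite (diagram_components ?\<nu>)"
      using k finite_diagram[of \<mu>] by (auto simp: diagram_components_def)
    moreover have "f_connected a \<kappa> (0 :: super_mps) 0 = 0" for \<kappa> by (simp add: f_connected_def)
    ultimately have "f_skew a ?\<nu> (0 :: super_mps) 0 = 0"
      unfolding f_skew_def by (intro prod_zero) auto
    then have "diagonal_strict_weight a \<mu> (zero_above n x) (zero_above n y) T = 0"
      unfolding diagonal_strict_weight_def using k finite_diagram[of \<mu>]
      by (intro prod_zero bexI[of _ k]) (auto simp: z)
    with nz show False ..
  qed
  ultimately show "k \<in> {1..n}" by simp
qed

lemma zero_above_idem: "zero_above n (zero_above n z) = zero_above n z"
  by (simp add: zero_above_def fun_eq_iff)

theorem theorem4p6: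
  fixes a :: "int \<Rightarrow> complex" and \<mu> :: "nat list" and N :: nat
  assumes "is_partition \<mu>" and "length \<mu> \<le> N"
  shows
    "(mps_summable (diagonal_strict_weight a \<mu> xvar yvar) (diagonal_strict_tableaux \<mu>) \<and>
      super_eval xvar yvar (multi_schur N \<mu> a) =
        mps_infsum (diagonal_strict_weight a \<mu> xvar yvar) (diagonal_strict_tableaux \<mu>)) \<and>
     (\<forall>n. (\<forall>T\<in>diagonal_strict_tableaux \<mu>.
             diagonal_strict_weight a \<mu> (zero_above n xvar) (zero_above n yvar) T \<noteq> 0 \<longrightarrow>
             T ` diagram \<mu> \<subseteq> {1..n}) \<and>
          super_eval (zero_above n xvar) (zero_above n yvar) (multi_schur N \<mu> a) =
            (\<Sum>T\<in>{T \<in> diagonal_strict_tableaux \<mu>. T ` diagram \<mu> \<subseteq> {1..n}}.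
               diagonal_strict_weight a \<mu> (zero_above n xvar) (zero_above n yvar) T)) \<and>
     (\<forall>n\<ge>1. super_eval (zero_above n xvar) (zero_above n yvar) (multi_schur N \<mu> a) =
          (\<Sum>T\<in>letter_tableaux \<mu> n.
             letter_weight a \<mu> n (zero_above n xvar) (zero_above n yvar) T))"
proof -
  let ?S = "diagonal_strict_tableaux \<mu>"
  define D where "D n = {T \<in> ?S. T ` diagram \<mu> \<subseteq> {1..n}}" for n
  define W where "W = diagonal_strict_weight a \<mu> xvar yvar"
  define Wn where "Wn n = diagonal_strict_weight a \<mu> (zero_above n xvar) (zero_above n yvar)" for n
  let ?s = "multi_schur N \<mu> a"
  have vanish: "T \<in> D n" if "T \<in> ?S" "Wn n T \<noteq> 0" for n T
    using diagonal_strict_weight_vanishes that by (auto simp: D_def Wn_def)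
  have letters: "super_eval (zero_above n xvar) (zero_above n yvar) ?s =
      (\<Sum>T\<in>letter_tableaux \<mu> n. \<Prod>s\<in>diagram \<mu>. letter_factor a (zero_above n xvar) (zero_above n yvar) (T s) s)" for n
    using super_eval_schur_letter_tableaux[OF assms, where n = n and x = "zero_above n xvar" and y = "zero_above n yvar"]
    by (simp only: zero_above_idem)
  have fin: "super_eval (zero_above n xvar) (zero_above n yvar) ?s = sum (Wn n) (D n)" for n
    unfolding letters sum_letter_tableaux_eq_diagonal_strict[OF assms(1)] D_def Wn_def ..
  have finD: "finite (D n)" for n
    unfolding D_def by (rule finite_diagonal_strict_upto)
  have coeff: "\<exists>n. {T \<in> ?S. mps_coeff (W T) m \<noteq> 0} \<subseteq> D n \<and>
      (\<forall>T\<in>?S. mps_coeff (W T) m = mps_coeff (Wn n T) m) \<and>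
      mps_coeff (super_eval xvar yvar ?s) m = mps_coeff (sum (Wn n) (D n)) m" for m
  proof -
    obtain n where n: "mps_coeff (truncate n f) m = mps_coeff f m" for f
      using coeff_truncate_large by blast
    have W: "mps_coeff (W T) m = mps_coeff (Wn n T) m" if "T \<in> ?S" for T
      using n[of "W T"] truncate_diagonal_strict_weight[OF that] by (simp add: W_def Wn_def)
    have "T \<in> D n" if "T \<in> ?S" "mps_coeff (W T) m \<noteq> 0" for T
    proof (rule vanish[OF that(1)])
      show "Wn n T \<noteq> 0" using that(2) W[OF that(1)] by (auto simp: zero_mps_def)
    qed
    moreover have "mps_coeff (super_eval xvar yvar ?s) m = mps_coeff (sum (Wn n) (D n)) m"
      unfolding fin[symmetric] truncate_super_eval[symmetric] n ..
    ultimately show ?thesis using W by blast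
  qed
  have "mps_summable W ?S"
    unfolding mps_summable_def using coeff finD finite_subset by meson
  moreover have "super_eval xvar yvar ?s = mps_infsum W ?S"
  proof (rule mps_eqI)
    fix m
    obtain n where n: "{T \<in> ?S. mps_coeff (W T) m \<noteq> 0} \<subseteq> D n"
      "\<And>T. T \<in> ?S \<Longrightarrow> mps_coeff (W T) m = mps_coeff (Wn n T) m"
      "mps_coeff (super_eval xvar yvar ?s) m = mps_coeff (sum (Wn n) (D n)) m"
      using coeff by meson
    have "mps_coeff (mps_infsum W ?S) m = (\<Sum>T\<in>D n. mps_coeff (W T) m)"
      unfolding mps_infsum_def mps_coeff_Abs using n(1) finD
      by (intro sum.mono_neutral_left) (auto simp: D_def)
    also have "\<dots> = (\<Sum>T\<in>D n. mps_coeff (Wn n T) m)"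
      by (intro sum.cong refl n(2)) (simp add: D_def)
    finally show "mps_coeff (super_eval xvar yvar ?s) m = mps_coeff (mps_infsum W ?S) m"
      by (simp add: n(3) mps_coeff_sum)
  qed
  moreover have "super_eval (zero_above n xvar) (zero_above n yvar) ?s =
      (\<Sum>T\<in>letter_tableaux \<mu> n. letter_weight a \<mu> n (zero_above n xvar) (zero_above n yvar) T)" for n
    unfolding letters by (intro sum.cong refl letter_weight_eq_prod[symmetric])
  ultimately show ?thesis
    using vanish fin unfolding W_def Wn_def D_def by blast
qed

end
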